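(* Let $\nu\ge 0$, $t>0$ and $\beta\in\mathbb{R}$. The conditional moment generating function of $X_\nu(t)$ is, for every integer $n\ge 1$, $$E\left\{e^{\beta X_\nu(t)}\,\middle|\,N(t)=n\right\}=\frac{n!}{t^n}\left(2^\nu\Gamma(\nu+1)\right)^{n+1}\int_0^t ds_1\int_{s_1}^t ds_2\cdots\int_{s_{n-1}}^t ds_n\prod_{j=1}^{n+1}\frac{I_\nu(\beta c(s_j-s_{j-1}))}{(\beta c(s_j-s_{j-1}))^\nu},$$ where $s_0=0$ and $s_{n+1}=t$, while for $n=0$ $$E\left\{e^{\beta X_\nu(t)}\,\middle|\,N(t)=0\right\}=\left(\frac{2}{\beta ct}\right)^\nu\Gamma(\nu+1)I_\nu(\beta ct).$$
   Context: Fix $c>0$, $\lambda>0$. For $\nu\ge0$ let $f_\nu(\theta)=\frac{\Gamma(\nu+1)}{\sqrt{\pi}\,\Gamma(\nu+\frac12)}\sin^{2\nu}\theta$, $\theta\in(0,\pi)$, a probability density. Let $N(t)$ be a homogeneous Poisson process of rate $\lambda$ with event times $s_1<s_2<\cdots$, and let $\theta_1,\theta_2,\dots$ be i.i.d. with density $f_\nu$, independent of $N$. The random motion is $X_\nu(t)=c\sum_{j=1}^{N(t)+1}(s_j-s_{j-1})\cos\theta_j$, with the conventions $s_0=0$ and $s_{N(t)+1}=t$. $I_\nu(x)=\sum_{k=0}^\infty\frac{(x/2)^{2k+\nu}}{\Gamma(k+1)\Gamma(k+\nu+1)}$ is the modified Bessel function. The quotient $I_\nu(z)/z^\nu$ is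 understood as the even entire function $2^{-\nu}\sum_{k\ge0}\frac{(z/2)^{2k}}{k!\,\Gamma(k+\nu+1)}$ (in particular also for $z\le0$). *)

theory Defs
  imports "HOL-Probability.Probability"
begin

text \<open>Counting-process definition of a homogeneous Poisson process of rate \<open>rate\<close> on
  \<open>[0, \<infinity>)\<close>. Paths are nondecreasing, so the truncated subtraction on \<^typ>\<open>nat\<close> is the true
  increment; right-continuity refers to the discrete topology of \<^typ>\<open>nat\<close>.
  Times \<open>t < 0\<close> are unconstrained and never used.\<close>

definition poisson_process :: "'a measure \<Rightarrow> real \<Rightarrow> (real \<Rightarrow> 'a \<Rightarrow> nat) \<Rightarrow> bool" where
  "poisson_process M rate N \<longleftrightarrow>
     (\<forall>t\<ge>0. N t \<in> measurable M (count_space UNIV)) \<and>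
     (\<forall>\<omega>\<in>space M. N 0 \<omega> = 0 \<and> mono_on {0..} (\<lambda>t. N t \<omega>) \<and>
        (\<forall>t\<ge>0. continuous (at_right t) (\<lambda>u. N u \<omega>))) \<and>
     (\<forall>(r :: nat \<Rightarrow> real) m. 0 \<le> r 0 \<and> mono r \<longrightarrow>
        prob_space.indep_vars M (\<lambda>_. count_space UNIV)
          (\<lambda>i \<omega>. N (r (Suc i)) \<omega> - N (r i) \<omega>) {..<m}) \<and>
     (\<forall>u t. 0 \<le> u \<and> u < t \<longrightarrow>
        distr M (count_space UNIV) (\<lambda>\<omega>. N t \<omega> - N u \<omega>)
          = measure_pmf (poisson_pmf (rate * (t - u))))"

definition event_time :: "(real \<Rightarrow> 'a \<Rightarrow> nat) \<Rightarrow> nat \<Rightarrow> 'a \<Rightarrow> real" where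
  "event_time N k \<omega> = Inf {u. 0 \<le> u \<and> k \<le> N u \<omega>}"

text \<open>The event times up to time \<open>t\<close>, completed by \<open>s\<^sub>0 = 0\<close> and \<open>s\<^bsub>N(t)+1\<^esub> = t\<close>.\<close>

definition switch_time :: "(real \<Rightarrow> 'a \<Rightarrow> nat) \<Rightarrow> real \<Rightarrow> nat \<Rightarrow> 'a \<Rightarrow> real" where
  "switch_time N t j \<omega> =
     (if j = 0 then 0 else if j \<le> N t \<omega> then event_time N j \<omega> else t)"

definition angle_density :: "real \<Rightarrow> real \<Rightarrow> real" where
  "angle_density \<nu> x =
     Gamma (\<nu> + 1) / (sqrt pi * Gamma (\<nu> + 1 / 2)) * sin x powr (2 * \<nu>)
       * indicator {0<..<pi} x"

definition random_motion ::
  "real \<Rightarrow> (real \<Rightarrow> 'a \<Rightarrow> nat) \<Rightarrow> (nat \<Rightarrow> 'a \<Rightarrow> real) \<Rightarrow> real \<Rightarrow> 'a \<Rightarrow> real" where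
  "random_motion c N \<theta> t \<omega> =
     c * (\<Sum>j = 1..N t \<omega> + 1.
            (switch_time N t j \<omega> - switch_time N t (j - 1) \<omega>) * cos (\<theta> j \<omega>))"

text \<open>The \<open>\<sigma>\<close>-algebra on \<open>\<Omega>\<close> generated by a family \<open>(Y i)\<close>, \<open>i \<in> I\<close>, of random variables
  with values in \<open>S\<close>.\<close>

definition generated_sigma ::
  "'a measure \<Rightarrow> 'i set \<Rightarrow> 'b measure \<Rightarrow> ('i \<Rightarrow> 'a \<Rightarrow> 'b) \<Rightarrow> 'a set set" where
  "generated_sigma M I S Y =
     sets (vimage_algebra (space M) (\<lambda>\<omega>. \<lambda>i\<in>I. Y i \<omega>) (PiM I (\<lambda>_. S)))"

definition cond_expect_event :: "'a measure \<Rightarrow> ('a \<Rightarrow> real) \<Rightarrow> ('a \<Rightarrow> bool) \<Rightarrow> real" where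
  "cond_expect_event M f P = integral\<^sup>L (uniform_measure M {\<omega> \<in> space M. P \<omega>}) f"

text \<open>The modified Bessel function for positive argument (real powers of nonpositive
  arguments are not meaningful), and the even entire function understood by the quotient
  \<open>I\<^sub>\<nu>(z) / z\<^sup>\<nu>\<close>, restricted to real \<open>z\<close>.\<close>

definition bessel_I :: "real \<Rightarrow> real \<Rightarrow> real" where
  "bessel_I \<nu> x =
     (\<Sum>k. (x / 2) powr (2 * real k + \<nu>) / (Gamma (real k + 1) * Gamma (real k + \<nu> + 1)))"

definition bessel_I_quot :: "real \<Rightarrow> real \<Rightarrow> real" where
  "bessel_I_quot \<nu> z =
     2 powr (- \<nu>) * (\<Sum>k. (z / 2) ^ (2 * k) / (fact k * Gamma (real k + \<nu> + 1)))"

lemma summable_bessel_I_quot: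
  fixes \<nu> z :: real
  assumes "\<nu> \<ge> 0"
  shows "summable (\<lambda>k. (z / 2) ^ (2 * k) / (fact k * Gamma (real k + \<nu> + 1)))"
proof (rule summable_comparison_test')
  show "summable (\<lambda>k. (inverse (fact k) * ((z / 2)\<^sup>2) ^ k) * (1 / Gamma (\<nu> + 1)))"
    by (intro summable_mult2 summable_exp)
  fix k :: nat
  have ge1: "pochhammer (\<nu> + 1) k \<ge> 1"
  proof (induction k)
    case (Suc k)
    then show ?case
      using assms mult_mono[of 1 "pochhammer (\<nu> + 1) k" 1 "\<nu> + 1 + real k"]
      by (simp add: pochhammer_Suc)
  qed simp
  have pos: "Gamma (\<nu> + 1) > 0"
    using assms by (intro Gamma_real_pos) simp
  have "\<nu> + 1 \<notin> \<int>\<^sub>\<le>\<^sub>0"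
    using assms by (auto elim!: nonpos_Ints_cases)
  then have "pochhammer (\<nu> + 1) k = Gamma (\<nu> + 1 + real k) / Gamma (\<nu> + 1)"
    by (rule pochhammer_Gamma)
  then have "Gamma (real k + \<nu> + 1) = Gamma (\<nu> + 1) * pochhammer (\<nu> + 1) k"
    using pos by (simp add: add_ac)
  then have le: "Gamma (\<nu> + 1) \<le> Gamma (real k + \<nu> + 1)"
    using ge1 pos mult_left_mono[of 1 "pochhammer (\<nu> + 1) k" "Gamma (\<nu> + 1)"] by linarith
  have "norm ((z / 2) ^ (2 * k) / (fact k * Gamma (real k + \<nu> + 1)))
      = ((z / 2)\<^sup>2) ^ k / fact k * (1 / Gamma (real k + \<nu> + 1))"
    using le pos by (simp add: power_mult abs_mult)
  also have "\<dots> \<le> ((z / 2)\<^sup>2) ^ k / fact k * (1 / Gamma (\<nu> + 1))"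
    using le pos by (intro mult_left_mono divide_left_mono) auto
  finally show "norm ((z / 2) ^ (2 * k) / (fact k * Gamma (real k + \<nu> + 1)))
      \<le> (inverse (fact k) * ((z / 2)\<^sup>2) ^ k) * (1 / Gamma (\<nu> + 1))"
    by (simp only: divide_inverse_commute)
qed

lemma bessel_I_quot_eq:
  assumes "\<nu> \<ge> 0" and z: "z > 0"
  shows "bessel_I \<nu> z / z powr \<nu> = bessel_I_quot \<nu> z"
proof -
  have eq: "(z / 2) powr (2 * real k + \<nu>) / (Gamma (real k + 1) * Gamma (real k + \<nu> + 1))
      = (z / 2) powr \<nu> * ((z / 2) ^ (2 * k) / (fact k * Gamma (real k + \<nu> + 1)))" for k
  proof -
    have "(z / 2) powr (2 * real k) = (z / 2) ^ (2 * k)"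
      using z powr_realpow[of "z / 2" "2 * k"] by simp
    moreover have "Gamma (real k + 1) = fact k"
      using Gamma_fact[of k, where 'a = real] by (simp add: add.commute)
    ultimately show ?thesis
      by (simp add: powr_add)
  qed
  have "bessel_I \<nu> z
      = (z / 2) powr \<nu> * (\<Sum>k. (z / 2) ^ (2 * k) / (fact k * Gamma (real k + \<nu> + 1)))"
    unfolding bessel_I_def eq by (rule suminf_mult[OF summable_bessel_I_quot[OF assms(1)]])
  moreover have "(z / 2) powr \<nu> = 2 powr (- \<nu>) * z powr \<nu>"
    using z by (simp add: powr_divide powr_minus_divide)
  ultimately show ?thesis
    using z by (simp add: bessel_I_quot_def)
qed

text \<open>\<open>n\<close> nested integrals of \<open>g [s\<^sub>1, \<dots>, s\<^sub>n]\<close>: the outermost variable \<open>s\<^sub>1\<close> ranges over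
  \<open>[a, t]\<close> and each \<open>s\<^bsub>i+1\<^esub>\<close> over \<open>[s\<^sub>i, t]\<close>.\<close>

fun iterated_integral :: "real \<Rightarrow> nat \<Rightarrow> real \<Rightarrow> (real list \<Rightarrow> real) \<Rightarrow> real" where
  "iterated_integral t 0 a g = g []"
| "iterated_integral t (Suc n) a g =
     (LBINT s:{a..t}. iterated_integral t n s (\<lambda>ss. g (s # ss)))"

end

theory Submission
  imports Defs
begin

text \<open>Conditionally on the switching times the motion is a sum of independent terms, so its moment
  generating function is a product of factors \<open>E exp (z cos \<theta>)\<close>; integrating the derivative of
  \<open>cos\<^sup>j \<theta> sin\<^bsup>2\<nu>+1\<^esup> \<theta>\<close> gives a recurrence for the moments of \<open>cos \<theta>\<close>, which identifies each factor
  with a multiple of the Bessel quotient. On \<open>N t = n\<close> the switching times have constant density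
  \<open>rate\<^sup>n exp (- rate t)\<close> on the simplex \<open>0 < s\<^sub>1 < \<dots> < s\<^sub>n < t\<close>: independence of the increments gives
  this on products of consecutive disjoint intervals, and these form an intersection-stable
  generator of the Borel sets of the simplex.\<close>

section \<open>The moment generating function of a direction\<close>

text \<open>The computation runs in nonnegative extended integrals: the exponential is positive, so
  Tonelli and the product formulas need no integrability, and finiteness is read off the result. The
  iterated Bochner integral of the statement is less forgiving, since its value defaults to 0 where
  integrability fails; measurability and a uniform bound are therefore carried through its
  induction. The normalising constant of \<open>angle_density\<close> is never evaluated: that an
  angle has this density already forces total mass one, and this starts the moment recurrence.
  Switching times are infima along a path, hence out of direct reach of the increments;
  right-continuity turns \<open>switch_time N t j \<omega> \<le> u\<close> into a condition on the
  count at time \<open>u\<close>. The factor \<open>n! / t^n\<close> is the quotient of the constant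
  density by P(N(t) = n) = rate^n exp(- rate t) t^n / n!, in which the rate cancels.\<close>

lemma angle_density_nonneg: "\<nu> \<ge> 0 \<Longrightarrow> angle_density \<nu> x \<ge> 0"
  by (auto simp: angle_density_def indicator_def intro!: mult_nonneg_nonneg divide_nonneg_nonneg
      Gamma_real_nonneg)

lemma borel_measurable_angle_density [measurable]: "angle_density \<nu> \<in> borel_measurable borel"
  unfolding angle_density_def by measurable

lemma integrable_angle_density_mult:
  assumes "integrable lborel (angle_density \<nu>)" "\<nu> \<ge> 0"
    and "g \<in> borel_measurable borel" "\<And>x. \<bar>g x\<bar> \<le> B"
  shows "integrable lborel (\<lambda>x. angle_density \<nu> x * g x)"
proof (rule Bochner_Integration.integrable_bound)
  show "integrable lborel (\<lambda>x. angle_density \<nu> x * B)"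
    using assms(1) by simp
  show "AE x in lborel. norm (angle_density \<nu> x * g x) \<le> norm (angle_density \<nu> x * B)"
    using assms(4) angle_density_nonneg[OF assms(2)] 
    by (intro AE_I2) (auto simp: abs_mult intro!: mult_left_mono order_trans[OF _ abs_ge_self])
qed (use assms(3) in measurable)

text \<open>The integrand is a multiple of the derivative of \<open>cos\<^sup>j sin\<^bsup>2\<nu>+1\<^esup>\<close>.\<close>

lemma angle_density_by_parts:
  assumes \<nu>: "\<nu> \<ge> 0" and int: "integrable lborel (angle_density \<nu>)"
  shows "(LBINT x. angle_density \<nu> x *
      ((2 * \<nu> + 1) * cos x ^ (j + 1) - real j * cos x ^ (j - 1) * (sin x)\<^sup>2)) = 0"
proof -
  define C where "C = Gamma (\<nu> + 1) / (sqrt pi * Gamma (\<nu> + 1 / 2))"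
  define F where "F x = C * (cos x ^ j * sin x powr (2 * \<nu> + 1))" for x :: real
  define g where "g x = (2 * \<nu> + 1) * cos x ^ (j + 1) - real j * cos x ^ (j - 1) * (sin x)\<^sup>2"
    for x :: real
  have "(F has_vector_derivative angle_density \<nu> x * g x) (at x)" if x: "x \<in> {0<..<pi}" for x
  proof -
    have s: "sin x > 0" using x by (simp add: sin_gt_zero)
    have "(F has_real_derivative C * (real j * cos x ^ (j - 1) * - sin x * sin x powr (2 * \<nu> + 1)
        + cos x ^ j * ((2 * \<nu> + 1) * sin x powr (2 * \<nu>) * cos x))) (at x)"
      unfolding F_def using s
      by (auto intro!: derivative_eq_intros simp: powr_diff algebra_simps)
    also have "C * (real j * cos x ^ (j - 1) * - sin x * sin x powr (2 * \<nu> + 1)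
        + cos x ^ j * ((2 * \<nu> + 1) * sin x powr (2 * \<nu>) * cos x)) =
        (C * sin x powr (2 * \<nu>)) * g x"
      using s by (simp add: g_def powr_add algebra_simps power2_eq_square)
    also have "C * sin x powr (2 * \<nu>) = angle_density \<nu> x"
      using x by (simp add: angle_density_def C_def)
    finally show ?thesis by (simp add: has_real_derivative_iff_has_vector_derivative)
  qed
  \<comment> \<open>At 0 and pi the base of \<open>powr\<close> is 0, so the derivative is taken
    only inside; continuity up to the ends suffices for the fundamental theorem. \<open>F\<close> is
    0 at both ends, so no boundary term remains.\<close>
  moreover have "continuous_on {0..pi} F"
    unfolding F_def using \<nu> by (intro continuous_intros continuous_on_powr') (auto simp: sin_ge_zero)
  ultimately have "((\<lambda>x. angle_density \<nu> x * g x) has_integral F pi - F 0) {0..pi}"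
    by (intro fundamental_theorem_of_calculus_interior) auto
  then have hi: "((\<lambda>x. angle_density \<nu> x * g x) has_integral 0) {0..pi}"
    by (simp add: F_def)
  have c: "\<bar>cos x ^ m\<bar> \<le> 1" for m and x :: real
    by (simp add: power_abs power_le_one)
  have "\<bar>g x\<bar> \<le> (2 * \<nu> + 1) + real j" for x
  proof -
    have "\<bar>g x\<bar> \<le> \<bar>(2 * \<nu> + 1) * cos x ^ (j + 1)\<bar> + \<bar>real j * (cos x ^ (j - 1) * (sin x)\<^sup>2)\<bar>"
      unfolding g_def by (simp only: mult.assoc abs_triangle_ineq4)
    also have "\<dots> \<le> (2 * \<nu> + 1) * 1 + real j * (1 * 1)"
      unfolding abs_mult using \<nu>
      by (intro add_mono mult_mono c) (auto simp: abs_square_le_1)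
    finally show ?thesis by simp
  qed
  then have i: "integrable lborel (\<lambda>x. angle_density \<nu> x * g x)"
    by (intro integrable_angle_density_mult[OF int \<nu>]) (auto simp: g_def)
  \<comment> \<open>The density vanishes off the open interval, so the integral over
    \<open>{0..pi}\<close> is the integral over the line.\<close>
  have eq: "indicator {0..pi} x *\<^sub>R (angle_density \<nu> x * g x) = angle_density \<nu> x * g x" for x
    by (auto simp: angle_density_def indicator_def)
  have "set_integrable lborel {0..pi} (\<lambda>x. angle_density \<nu> x * g x)"
    using i unfolding set_integrable_def eq .
  from set_borel_integral_eq_integral(2)[OF this] hi show ?thesis
    unfolding set_lebesgue_integral_def eq g_def[symmetric] by (simp add: integral_unique)
qed

text \<open>Integration by parts with exponent \<open>Suc j\<close>, after sin^2 = 1 - cos^2, leaves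
  only two powers of the cosine, two degrees apart.\<close>

lemma angle_density_cos_moment_rec:
  assumes \<nu>: "\<nu> \<ge> 0" and int: "integrable lborel (angle_density \<nu>)"
  shows "(real j + 2 * \<nu> + 2) * (LBINT x. angle_density \<nu> x * cos x ^ (j + 2)) =
    (real j + 1) * (LBINT x. angle_density \<nu> x * cos x ^ j)"
proof -
  have i: "integrable lborel (\<lambda>x. angle_density \<nu> x * cos x ^ m)" for m
    by (rule integrable_angle_density_mult[OF int \<nu>, where B = 1])
       (auto simp: power_abs power_le_one)
  have "angle_density \<nu> x * ((2 * \<nu> + 1) * cos x ^ (Suc j + 1) - real (Suc j) * cos x ^ (Suc j - 1) * (sin x)\<^sup>2)
      = (real j + 2 * \<nu> + 2) * (angle_density \<nu> x * cos x ^ (j + 2))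
      - (real j + 1) * (angle_density \<nu> x * cos x ^ j)" for x
    unfolding sin_squared_eq by (simp add: algebra_simps power2_eq_square)
  then have "0 = (LBINT x. (real j + 2 * \<nu> + 2) * (angle_density \<nu> x * cos x ^ (j + 2))
      - (real j + 1) * (angle_density \<nu> x * cos x ^ j))"
    using angle_density_by_parts[OF \<nu> int, of "Suc j"] by simp
  also have "\<dots> = (real j + 2 * \<nu> + 2) * (LBINT x. angle_density \<nu> x * cos x ^ (j + 2))
      - (real j + 1) * (LBINT x. angle_density \<nu> x * cos x ^ j)"
    by (simp only: Bochner_Integration.integral_diff[OF integrable_mult_right[OF i] integrable_mult_right[OF i]]
        integral_mult_right_zero)
  finally show ?thesis by simp
qed

text \<open>The case j = 0 of the integration by parts makes the mean of the cosine vanish, and the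
  recurrence carries this zero to every odd degree.\<close>

lemma angle_density_cos_odd_moment:
  assumes \<nu>: "\<nu> \<ge> 0" and int: "integrable lborel (angle_density \<nu>)"
  shows "(LBINT x. angle_density \<nu> x * cos x ^ (2 * k + 1)) = 0"
proof (induction k)
  case 0
  have "(LBINT x. (2 * \<nu> + 1) * (angle_density \<nu> x * cos x)) = 0"
    using angle_density_by_parts[OF \<nu> int, of 0] by (simp add: mult.left_commute)
  then show ?case using \<nu> by (simp del: integral_mult_right integral_mult_right_zero add: integral_mult_right_zero)
next
  case (Suc k)
  show ?case
    using angle_density_cos_moment_rec[OF \<nu> int, of "2 * k + 1"] Suc \<nu> by (simp add: add_nonneg_eq_0_iff)
qed

text \<open>Each step of the recurrence multiplies by (2k + 1) / (2 (k + \<nu> + 1)); the numerators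
  collect to (2k)! / (2^k k!), the denominators to 2^k Gamma(k + \<nu> + 1) / Gamma(\<nu> +
  1).\<close>

lemma angle_density_cos_even_moment:
  assumes \<nu>: "\<nu> \<ge> 0" and int: "integrable lborel (angle_density \<nu>)"
    and one: "(LBINT x. angle_density \<nu> x) = 1"
  shows "(LBINT x. angle_density \<nu> x * cos x ^ (2 * k)) =
    fact (2 * k) * Gamma (\<nu> + 1) / (4 ^ k * fact k * Gamma (real k + \<nu> + 1))"
proof (induction k)
  case 0
  have "Gamma (\<nu> + 1) > 0" using \<nu> by (intro Gamma_real_pos) simp
  then show ?case using one by simp
next
  case (Suc k)
  define m where "m = (LBINT x. angle_density \<nu> x * cos x ^ (2 * Suc k))"
  have "real k + \<nu> + 1 \<notin> \<int>\<^sub>\<le>\<^sub>0" using \<nu> by (auto elim!: nonpos_Ints_cases)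
  then have G: "Gamma (1 + real k + \<nu> + 1) = (real k + \<nu> + 1) * Gamma (real k + \<nu> + 1)"
    using Gamma_plus1[of "real k + \<nu> + 1"] by (simp add: add_ac)
  have pos: "Gamma (real k + \<nu> + 1) > 0" using \<nu> by (intro Gamma_real_pos) simp
  have "2 * (real k + \<nu> + 1) * m = (2 * real k + 1) * 
      (fact (2 * k) * Gamma (\<nu> + 1) / (4 ^ k * fact k * Gamma (real k + \<nu> + 1)))"
    using angle_density_cos_moment_rec[OF \<nu> int, of "2 * k"]
    unfolding Suc.IH m_def by (simp add: distrib_left mult.assoc add.assoc)
  moreover have q: "2 * (real k + \<nu> + 1) \<noteq> 0" using \<nu> by simp
  ultimately have m: "m = (2 * real k + 1) * 
      (fact (2 * k) * Gamma (\<nu> + 1) / (4 ^ k * fact k * Gamma (real k + \<nu> + 1))) / (2 * (real k + \<nu> + 1))"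
    using q by (metis eq_divide_imp mult.commute)
  have f: "fact (2 * Suc k) = (2 * (1 + real k)) * ((2 * real k + 1) * fact (2 * k))"
    by (simp add: algebra_simps)
  \<comment> \<open>Factorials and Gamma values enter as opaque variables, which leaves a rational
    identity; \<open>r\<close> stands for k + 1, which cancels between
    \<open>fact (2 * Suc k)\<close> and \<open>fact (Suc k)\<close>.\<close>
  have key: "a * (F * G / (c * f * H)) / (2 * q) = (2 * r) * (a * F) * G / (4 * c * (r * f) * (q * H))"
    if "r \<noteq> 0" for a F G c f H q r :: real
    using that by (simp add: divide_simps)
  show ?case
    unfolding m_def[symmetric] m f fact_Suc[of k] power_Suc[of 4] of_nat_Suc G by (rule key) simp
qed

text \<open>The exponential series is integrated term by term. Odd moments vanish; in the even ones
  (2k)! cancels and 4^k turns z^(2k) into (z/2)^(2k). The factor \<open>2 powr \<nu>\<close> undoes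
  the \<open>2 powr (- \<nu>)\<close> in \<open>bessel_I_quot\<close>.\<close>

lemma angle_density_mgf:
  assumes \<nu>: "\<nu> \<ge> 0" and int: "integrable lborel (angle_density \<nu>)"
    and one: "(LBINT x. angle_density \<nu> x) = 1"
  shows "(LBINT x. angle_density \<nu> x * exp (z * cos x)) =
    2 powr \<nu> * Gamma (\<nu> + 1) * bessel_I_quot \<nu> z"
proof -
  define f where "f m x = angle_density \<nu> x * ((z * cos x) ^ m / fact m)" for m x
  have i: "integrable lborel (f m)" for m
    unfolding f_def
    by (intro integrable_angle_density_mult[OF int \<nu>, where B = "\<bar>z\<bar> ^ m / fact m"])
       (auto simp: abs_mult power_abs intro!: divide_right_mono power_mono mult_left_le)
  have nf: "norm (f m x) \<le> angle_density \<nu> x * (\<bar>z\<bar> ^ m / fact m)" for m x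
    unfolding f_def using angle_density_nonneg[OF \<nu>, of x]
    by (auto simp: abs_mult power_abs intro!: mult_left_mono divide_right_mono power_mono mult_left_le)
  have se: "summable (\<lambda>m. y ^ m / fact m)" for y :: real
    using summable_exp[of y] by (simp add: divide_inverse mult.commute)
  have "(\<lambda>m. integral\<^sup>L lborel (f m)) sums (LBINT x. (\<Sum>m. f m x))"
  proof (rule sums_integral[OF i])
    show "AE x in lborel. summable (\<lambda>m. norm (f m x))"
      by (intro AE_I2 summable_comparison_test'[OF summable_mult[OF se]]) (use nf in auto)
    \<comment> \<open>As |cos| <= 1 and the mass is one, term \<open>m\<close> has integral norm at
      most |z|^m / m!.\<close>
    show "summable (\<lambda>m. LBINT x. norm (f m x))"
    proof (rule summable_comparison_test'[OF se])
      fix m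
      have "(LBINT x. norm (f m x)) \<le> (LBINT x. angle_density \<nu> x * (\<bar>z\<bar> ^ m / fact m))"
        using nf i int by (intro integral_mono) auto
      then show "norm (LBINT x. norm (f m x)) \<le> \<bar>z\<bar> ^ m / fact m"
        using one by simp
    qed
  qed
  moreover have "(\<Sum>m. f m x) = angle_density \<nu> x * exp (z * cos x)" for x
    unfolding f_def using exp_converges[of "z * cos x"]
    by (subst suminf_mult) (auto simp: se sums_iff scaleR_conv_of_real divide_inverse mult.commute)
  ultimately have S: "(\<lambda>m. integral\<^sup>L lborel (f m)) sums (LBINT x. angle_density \<nu> x * exp (z * cos x))"
    by simp
  have mom: "integral\<^sup>L lborel (f m) = z ^ m / fact m * (LBINT x. angle_density \<nu> x * cos x ^ m)" for m
    by (subst integral_mult_right_zero[symmetric]) (simp add: f_def[abs_def] power_mult_distrib mult_ac)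
  have "(\<lambda>k. integral\<^sup>L lborel (f (2 * k))) sums (LBINT x. angle_density \<nu> x * exp (z * cos x))"
  proof (subst sums_mono_reindex)
    show "strict_mono ((*) (2 :: nat))" by (simp add: strict_mono_def)
    fix m :: nat assume "m \<notin> range ((*) 2)"
    then have "odd m" by (auto elim: evenE)
    then obtain k where "m = 2 * k + 1" by (elim oddE)
    then show "integral\<^sup>L lborel (f m) = 0"
      using mom angle_density_cos_odd_moment[OF \<nu> int, of k] by simp
  qed fact
  moreover have "integral\<^sup>L lborel (f (2 * k)) =
     Gamma (\<nu> + 1) * ((z / 2) ^ (2 * k) / (fact k * Gamma (real k + \<nu> + 1)))" for k
  proof -
    have "(2 :: real) ^ (2 * k) = 4 ^ k" by (simp add: power_mult)
    then show ?thesis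
      unfolding mom angle_density_cos_even_moment[OF \<nu> int one] power_divide by (simp add: mult_ac)
  qed
  ultimately have "(\<lambda>k. Gamma (\<nu> + 1) * ((z / 2) ^ (2 * k) / (fact k * Gamma (real k + \<nu> + 1)))) sums
      (LBINT x. angle_density \<nu> x * exp (z * cos x))"
    by (simp only:)
  from sums_unique2[OF this sums_mult[OF summable_sums[OF summable_bessel_I_quot[OF \<nu>]]]] show ?thesis
    by (simp add: bessel_I_quot_def powr_minus)
qed

section \<open>Bounds for the Bessel quotient\<close>

lemma borel_measurable_bessel_I_quot [measurable]: "bessel_I_quot \<nu> \<in> borel_measurable borel"
  unfolding bessel_I_quot_def by measurable

lemma bessel_I_quot_nonneg: "\<nu> \<ge> 0 \<Longrightarrow> bessel_I_quot \<nu> z \<ge> 0"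
  unfolding bessel_I_quot_def
  by (intro mult_nonneg_nonneg suminf_nonneg summable_bessel_I_quot)
     (auto simp: power_mult intro!: divide_nonneg_nonneg mult_nonneg_nonneg Gamma_real_nonneg)

text \<open>Only even powers with nonnegative coefficients occur. This supplies the uniform bound on
  the integrand of the iterated integral.\<close>

lemma bessel_I_quot_mono:
  assumes "\<nu> \<ge> 0" "\<bar>z\<bar> \<le> y"
  shows "bessel_I_quot \<nu> z \<le> bessel_I_quot \<nu> y"
  unfolding bessel_I_quot_def
proof (intro mult_left_mono suminf_le summable_bessel_I_quot assms)
  fix k
  have "(z / 2) ^ (2 * k) = (\<bar>z\<bar> / 2) ^ (2 * k)"
    by (simp add: power_mult power_divide)
  also have "\<dots> \<le> (y / 2) ^ (2 * k)"
    using assms by (intro power_mono) auto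
  finally show "(z / 2) ^ (2 * k) / (fact k * Gamma (real k + \<nu> + 1))
      \<le> (y / 2) ^ (2 * k) / (fact k * Gamma (real k + \<nu> + 1))"
    using assms by (intro divide_right_mono mult_nonneg_nonneg Gamma_real_nonneg) auto
qed simp

lemma nn_integral_angle_density_mgf:
  assumes \<nu>: "\<nu> \<ge> 0" and "prob_space (density lborel (\<lambda>x. ennreal (angle_density \<nu> x)))"
  shows "(\<integral>\<^sup>+x. ennreal (exp (z * cos x)) \<partial>density lborel (\<lambda>x. ennreal (angle_density \<nu> x))) =
    ennreal (2 powr \<nu> * Gamma (\<nu> + 1) * bessel_I_quot \<nu> z)"
proof -
  have e: "(\<integral>\<^sup>+x. ennreal (angle_density \<nu> x) \<partial>lborel) = 1"
    using prob_space.emeasure_space_1[OF assms(2)] by (simp add: emeasure_density)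
  have int: "integrable lborel (angle_density \<nu>)"
    by (intro integrableI_nonneg) (auto simp: e angle_density_nonneg \<nu>)
  have one: "(LBINT x. angle_density \<nu> x) = 1"
    by (subst integral_eq_nn_integral) (auto simp: e angle_density_nonneg \<nu>)
  have "\<bar>exp (z * cos x)\<bar> \<le> exp \<bar>z\<bar>" for x
  proof -
    have "z * cos x \<le> \<bar>z * cos x\<bar>" by simp
    also have "\<dots> \<le> \<bar>z\<bar>" unfolding abs_mult by (intro mult_left_le) auto
    finally show ?thesis by simp
  qed
  then have "integrable lborel (\<lambda>x. angle_density \<nu> x * exp (z * cos x))"
    by (intro integrable_angle_density_mult[OF int \<nu>, where B = "exp \<bar>z\<bar>"]) auto
  then have "(\<integral>\<^sup>+x. ennreal (angle_density \<nu> x * exp (z * cos x)) \<partial>lborel)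
      = ennreal (LBINT x. angle_density \<nu> x * exp (z * cos x))"
    by (rule nn_integral_eq_integral) (auto simp: angle_density_nonneg \<nu>)
  then show ?thesis
    by (subst nn_integral_density)
       (auto simp: angle_density_mgf[OF \<nu> int one] ennreal_mult' angle_density_nonneg \<nu>)
qed

section \<open>Iterated integrals over the order simplex\<close>

text \<open>Coordinates are numbered from \<open>k\<close> so that splitting off the first one
  leaves a simplex of the same kind, numbered from \<open>Suc k\<close> and bounded below by that
  coordinate; inductions then need no shift of indices.\<close>

definition open_order_simplex :: "nat \<Rightarrow> nat \<Rightarrow> real \<Rightarrow> real \<Rightarrow> (nat \<Rightarrow> real) set" where
  "open_order_simplex k m a t =
    {x \<in> {k..<k + m} \<rightarrow>\<^sub>E UNIV. \<forall>i\<in>{k..<k + m}. (if i = k then a else x (i - 1)) < x i \<and> x i < t}"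

lemma sets_open_order_simplex [measurable]:
  "open_order_simplex k m a t \<in> sets (PiM {k..<k + m} (\<lambda>_. borel))"
proof -
  have *: "open_order_simplex k m a t = {x \<in> space (PiM {k..<k + m} (\<lambda>_. borel)).
      \<forall>i\<in>{k..<k + m}. (if i = k then a else x (i - 1)) < x i \<and> x i < t}"
    by (simp add: open_order_simplex_def space_PiM)
  have "(\<lambda>x :: nat \<Rightarrow> real. if i = k then a else x (i - 1)) \<in> borel_measurable (PiM {k..<k + m} (\<lambda>_. borel))"
    if "i \<in> {k..<k + m}" for i
  proof (cases "i = k")
    case False
    then have "i - 1 \<in> {k..<k + m}" using that by auto
    then show ?thesis using False by simp
  qed simp
  then show ?thesis unfolding *
    by (intro sets.sets_Collect_finite_All sets.sets_Collect_conj borel_measurable_less) auto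
qed

lemma sets_open_order_simplex_lborel [measurable]:
  "open_order_simplex k m a t \<in> sets (PiM {k..<k + m} (\<lambda>_. lborel))"
  using sets_open_order_simplex by (simp cong: sets_PiM_cong)

lemma fun_upd_mem_open_order_simplex:
  assumes "x \<in> {Suc k..<Suc k + m} \<rightarrow>\<^sub>E UNIV"
  shows "x(k := y) \<in> open_order_simplex k (Suc m) a t \<longleftrightarrow>
    y \<in> {a<..<t} \<and> x \<in> open_order_simplex (Suc k) m y t"
proof -
  have "x(k := y) \<in> {k..<k + Suc m} \<rightarrow>\<^sub>E UNIV"
    using assms by (auto simp: PiE_def extensional_def)
  moreover have "{k..<k + Suc m} = insert k {Suc k..<Suc k + m}" by auto
  moreover have "(if i = k then a else (x(k := y)) (i - 1)) < (x(k := y)) i \<and> (x(k := y)) i < t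
      \<longleftrightarrow> (if i = Suc k then y else x (i - 1)) < x i \<and> x i < t"
    if "i \<in> {Suc k..<Suc k + m}" for i
    using that by (cases "i = Suc k") auto
  ultimately show ?thesis
    using assms by (simp add: open_order_simplex_def)
qed

text \<open>Tonelli, one coordinate at a time. The conclusions are proved together: sign and bound
  of the inner integral give integrability of the outer one, without which its Bochner value would
  be the default 0. Closed intervals may replace open ones because endpoints are null.\<close>

lemma iterated_integral_eq_nn_integral:
  assumes "a \<in> {0..t}"
    and "(\<lambda>x. g (map x [k..<k + m])) \<in> borel_measurable (PiM {k..<k + m} (\<lambda>_. lborel))"
    and "\<And>ss. set ss \<subseteq> {0..t} \<Longrightarrow> length ss = m \<Longrightarrow> 0 \<le> g ss \<and> g ss \<le> B"
  shows "0 \<le> iterated_integral t m a g \<and> iterated_integral t m a g \<le> B * t ^ m \<and>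
    ennreal (iterated_integral t m a g) =
      (\<integral>\<^sup>+x. ennreal (g (map x [k..<k + m])) * indicator (open_order_simplex k m a t) x
        \<partial>PiM {k..<k + m} (\<lambda>_. lborel))"
  using assms
proof (induction m arbitrary: k a g)
  case 0
  interpret product_sigma_finite "\<lambda>_ :: nat. lborel :: real measure" by standard
  show ?case using "0.prems"(3)[of "[]"]
    by (simp add: nn_integral_empty open_order_simplex_def)
next
  case (Suc m)
  interpret product_sigma_finite "\<lambda>_ :: nat. lborel :: real measure" by standard
  let ?J = "{Suc k..<Suc k + m}"
  let ?P = "PiM ?J (\<lambda>_. lborel :: real measure)"
  define h where "h s = iterated_integral t m s (\<lambda>ss. g (s # ss))" for s
  have t: "0 \<le> t" using Suc.prems(1) by simp
  \<comment> \<open>Any list to which the bound hypothesis applies shows that \<open>B\<close> is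
    nonnegative.\<close>
  have "set (replicate (Suc m) t) \<subseteq> {0..t}" using t by auto
  from Suc.prems(3)[OF this] have B: "0 \<le> B" by simp
  have ins: "{k..<k + Suc m} = insert k ?J" by auto
  have map_upd: "map (x(k := y)) [k..<k + Suc m] = y # map x [Suc k..<Suc k + m]"
    for x :: "nat \<Rightarrow> real" and y
    by (simp add: upt_conv_Cons del: upt_Suc)
  have IH: "0 \<le> h s" "h s \<le> B * t ^ m"
    "ennreal (h s) = (\<integral>\<^sup>+x. ennreal (g (s # map x [Suc k..<Suc k + m]))
       * indicator (open_order_simplex (Suc k) m s t) x \<partial>?P)" if s: "s \<in> {0..t}" for s
  proof -
    have "(\<lambda>x. x(k := s)) \<in> measurable ?P (PiM (insert k ?J) (\<lambda>_. lborel))"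
      by measurable
    from measurable_compose[OF this Suc.prems(2)[unfolded ins]]
    have "(\<lambda>x. g (s # map x [Suc k..<Suc k + m])) \<in> borel_measurable ?P"
      by (simp only: map_upd)
    moreover have "0 \<le> g (s # ss) \<and> g (s # ss) \<le> B" if "set ss \<subseteq> {0..t}" "length ss = m" for ss
      using Suc.prems(3)[of "s # ss"] s that by simp
    ultimately show "0 \<le> h s" "h s \<le> B * t ^ m"
      "ennreal (h s) = (\<integral>\<^sup>+x. ennreal (g (s # map x [Suc k..<Suc k + m]))
         * indicator (open_order_simplex (Suc k) m s t) x \<partial>?P)"
      using Suc.IH[of s "\<lambda>ss. g (s # ss)" "Suc k"] s unfolding h_def by auto
  qed
  define F where "F x = ennreal (g (map x [k..<k + Suc m])) * indicator (open_order_simplex k (Suc m) a t) x" for x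
  have F: "F \<in> borel_measurable (PiM (insert k ?J) (\<lambda>_. lborel))"
    using Suc.prems(2) sets_open_order_simplex_lborel[of k "Suc m" a t] unfolding F_def ins 
    by (intro borel_measurable_times_ennreal measurable_compose[OF _ measurable_ennreal] borel_measurable_indicator)
  have inner: "(\<integral>\<^sup>+x. F (x(k := y)) \<partial>?P) = ennreal (indicator {a<..<t} y * h y)" for y
  proof -
    have "(\<integral>\<^sup>+x. F (x(k := y)) \<partial>?P) = (\<integral>\<^sup>+x. indicator {a<..<t} y * (ennreal (g (y # map x [Suc k..<Suc k + m]))
       * indicator (open_order_simplex (Suc k) m y t) x) \<partial>?P)"
      unfolding F_def map_upd
      by (intro nn_integral_cong)
         (auto simp: fun_upd_mem_open_order_simplex space_PiM indicator_def)
    also have "\<dots> = ennreal (indicator {a<..<t} y * h y)"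
      using IH(3)[of y] Suc.prems(1) by (auto simp: indicator_def)
    finally show ?thesis .
  qed
  \<comment> \<open>\<open>h\<close> is controlled only on \<open>{0..t}\<close>, so its
    measurability is extracted from that of the inner integral, which vanishes off the open
    interval.\<close>
  have "(\<lambda>y. \<integral>\<^sup>+x. F (x(k := y)) \<partial>?P) \<in> borel_measurable lborel"
  proof -
    interpret P: sigma_finite_measure ?P by (rule sigma_finite) simp
    have "(\<lambda>p. (snd p)(k := fst p)) \<in> measurable (lborel \<Otimes>\<^sub>M ?P) (PiM (insert k ?J) (\<lambda>_. lborel))"
      using measurable_compose[OF measurable_Pair[OF measurable_snd measurable_fst] measurable_add_dim]
      by (simp add: case_prod_beta)
    from measurable_compose[OF this F] show ?thesis
      by (intro P.borel_measurable_nn_integral) (simp add: case_prod_beta)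
  qed
  then have "(\<lambda>y. enn2real (ennreal (indicator {a<..<t} y * h y))) \<in> borel_measurable borel"
    unfolding inner by simp
  moreover have "enn2real (ennreal (indicator {a<..<t} y * h y)) = indicator {a<..<t} y * h y" for y
    using IH(1)[of y] Suc.prems(1) by (auto simp: indicator_def)
  ultimately have "(\<lambda>y. indicator {a<..<t} y * h y) \<in> borel_measurable borel"
    by simp
  \<comment> \<open>Patching in two single values passes from the open to the closed
    interval.\<close>
  then have "(\<lambda>y. if y = a then h a else if y = t then h t else indicator {a<..<t} y * h y)
      \<in> borel_measurable borel"
    by measurable
  also have "(\<lambda>y. if y = a then h a else if y = t then h t else indicator {a<..<t} y * h y)
      = (\<lambda>y. indicator {a..t} y *\<^sub>R h y)"
    using Suc.prems(1) by (auto simp: fun_eq_iff indicator_def)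
  finally have meas: "(\<lambda>y. indicator {a..t} y *\<^sub>R h y) \<in> borel_measurable borel" .
  have nonneg: "0 \<le> indicator {a..t} y *\<^sub>R h y" for y
    using IH(1)[of y] Suc.prems(1) by (auto simp: indicator_def)
  have "(\<integral>\<^sup>+y. ennreal (indicator {a..t} y *\<^sub>R h y) \<partial>lborel) \<le> (\<integral>\<^sup>+y. ennreal (B * t ^ m) * indicator {a..t} y \<partial>lborel)"
    using IH(2) Suc.prems(1) by (intro nn_integral_mono) (auto simp: indicator_def intro!: ennreal_leI)
  also have "\<dots> = ennreal (B * t ^ m * (t - a))"
    using Suc.prems(1) t B by (simp add: nn_integral_cmult_indicator ennreal_mult)
  also have "\<dots> \<le> ennreal (B * t ^ Suc m)"
    using Suc.prems(1) t B mult_left_mono[of "t - a" t "B * t ^ m"] by (intro ennreal_leI) (simp add: mult_ac)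
  finally have bound: "(\<integral>\<^sup>+y. ennreal (indicator {a..t} y *\<^sub>R h y) \<partial>lborel) \<le> ennreal (B * t ^ Suc m)" .
  have eq: "iterated_integral t (Suc m) a g = enn2real (\<integral>\<^sup>+y. ennreal (indicator {a..t} y *\<^sub>R h y) \<partial>lborel)"
    unfolding iterated_integral.simps set_lebesgue_integral_def h_def[symmetric] using meas nonneg
    by (intro integral_eq_nn_integral) auto
  have fin: "(\<integral>\<^sup>+y. ennreal (indicator {a..t} y *\<^sub>R h y) \<partial>lborel) < \<top>"
    using bound by (rule le_less_trans) simp
  have "(\<integral>\<^sup>+y. ennreal (indicator {a..t} y *\<^sub>R h y) \<partial>lborel) = (\<integral>\<^sup>+y. \<integral>\<^sup>+x. F (x(k := y)) \<partial>?P \<partial>lborel)"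
    unfolding inner using AE_lborel_singleton[of a] AE_lborel_singleton[of t]
    by (intro nn_integral_cong_AE) (auto simp: indicator_def)
  also have "\<dots> = integral\<^sup>N (PiM {k..<k + Suc m} (\<lambda>_. lborel)) F"
    unfolding ins using F by (intro product_nn_integral_insert_rev[symmetric]) auto
  finally have "ennreal (iterated_integral t (Suc m) a g) = integral\<^sup>N (PiM {k..<k + Suc m} (\<lambda>_. lborel)) F"
    unfolding eq using fin by simp
  moreover have "iterated_integral t (Suc m) a g \<le> B * t ^ Suc m"
    unfolding eq using bound B t enn2real_leI[of "B * t ^ Suc m"] by simp
  ultimately show ?case
    unfolding F_def by (simp add: eq del: iterated_integral.simps upt_Suc)
qed

text \<open>The volume of the order simplex, to be matched with the Poisson weight of N(t) =
  n.\<close>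

lemma iterated_integral_const_1:
  assumes "a \<le> t"
  shows "iterated_integral t m a (\<lambda>_. 1) = (t - a) ^ m / fact m"
  using assms
proof (induction m arbitrary: a)
  case (Suc m)
  have "(LBINT s:{a..t}. iterated_integral t m s (\<lambda>_. 1)) = (LBINT s:{a..t}. (t - s) ^ m / fact m)"
    using Suc.IH by (intro set_lebesgue_integral_cong) auto
  also have "\<dots> = - ((t - t) ^ Suc m / fact (Suc m)) - - ((t - a) ^ Suc m / fact (Suc m))"
    unfolding set_lebesgue_integral_def
  proof (rule integral_FTC_atLeastAtMost[OF Suc.prems])
    fix x
    have "((\<lambda>x. - ((t - x) ^ Suc m / fact (Suc m))) has_real_derivative (real (Suc m) * (t - x) ^ m) / fact (Suc m)) (at x within {a..t})"
      by (auto intro!: derivative_eq_intros simp del: power_Suc fact_Suc)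
    then show "((\<lambda>x. - ((t - x) ^ Suc m / fact (Suc m))) has_vector_derivative (t - x) ^ m / fact m) (at x within {a..t})"
      unfolding has_real_derivative_iff_has_vector_derivative
      by (simp only: fact_Suc mult_divide_mult_cancel_left_if of_nat_neq_0 if_False)
  qed (intro continuous_intros, auto)
  finally show ?case by simp
qed simp

section \<open>Poisson processes and their event times\<close>

lemma event_time_nonneg:
  assumes "0 \<le> u" "k \<le> N u \<omega>"
  shows "0 \<le> event_time N k \<omega>"
  unfolding event_time_def using assms by (intro cInf_greatest) auto

text \<open>The hypothesis \<open>k \<le> N t \<omega>\<close> keeps the set under the infimum
  nonempty, and right-continuity makes the infimum belong to it; monotonicity does the rest.\<close>

lemma event_time_le_iff:
  assumes mono: "mono_on {0..} (\<lambda>u. N u \<omega>)"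
    and cont: "\<And>u. 0 \<le> u \<Longrightarrow> continuous (at_right u) (\<lambda>u. N u \<omega>)"
    and k: "0 \<le> t" "k \<le> N t \<omega>" and u: "0 \<le> u"
  shows "event_time N k \<omega> \<le> u \<longleftrightarrow> k \<le> N u \<omega>"
proof
  let ?S = "{u. 0 \<le> u \<and> k \<le> N u \<omega>}"
  have bdd: "bdd_below ?S" by (rule bdd_belowI[of _ 0]) auto
  show "event_time N k \<omega> \<le> u" if "k \<le> N u \<omega>"
    unfolding event_time_def using that u bdd by (intro cInf_lower) auto
  define i where "i = event_time N k \<omega>"
  have i: "0 \<le> i" unfolding i_def by (rule event_time_nonneg[of t k N \<omega>, OF k])
  then have "\<forall>\<^sub>F v in at_right i. N v \<omega> = N i \<omega>"
    using cont by (simp add: continuous_within tendsto_discrete)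
  \<comment> \<open>In a discrete space, right-continuity means that the path is constant on some
    interval to the right; a point of the set close above \<open>i\<close> therefore forces
    \<open>i\<close> into it.\<close>
  then obtain b where b: "i < b" "\<And>v. i < v \<Longrightarrow> v < b \<Longrightarrow> N v \<omega> = N i \<omega>"
    by (auto simp: eventually_at_right_field)
  have "?S \<noteq> {}" using k by auto
  from cInf_lessD[OF this b(1)[unfolded i_def event_time_def]] 
  obtain v where v: "0 \<le> v" "k \<le> N v \<omega>" "v < b" by auto
  moreover have "i \<le> v" unfolding i_def event_time_def using v bdd by (intro cInf_lower) auto
  ultimately have ki: "k \<le> N i \<omega>" using b(2)[of v] by (cases "v = i") auto
  show "k \<le> N u \<omega>" if "event_time N k \<omega> \<le> u"
    using ki mono_onD[OF mono, of i u] i u that unfolding i_def by auto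
qed

text \<open>Events about a switching time become conditions on the count at the deterministic time
  \<open>u\<close>. For \<open>j\<close> beyond the count at \<open>t\<close> the time is
  \<open>t\<close>, and for u < t monotonicity makes both sides false.\<close>

lemma switch_time_le_iff:
  assumes mono: "mono_on {0..} (\<lambda>u. N u \<omega>)"
    and cont: "\<And>u. 0 \<le> u \<Longrightarrow> continuous (at_right u) (\<lambda>u. N u \<omega>)"
    and t: "0 \<le> t" and j: "0 < j"
  shows "switch_time N t j \<omega> \<le> u \<longleftrightarrow> t \<le> u \<or> 0 \<le> u \<and> j \<le> N u \<omega>"
proof (cases "j \<le> N t \<omega>")
  case True
  have le: "event_time N j \<omega> \<le> v \<longleftrightarrow> j \<le> N v \<omega>" if "0 \<le> v" for v
    using event_time_le_iff[where N = N and \<omega> = \<omega>, OF mono cont t True that] .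
  have "0 \<le> event_time N j \<omega>" by (rule event_time_nonneg[of t j N \<omega>, OF t True])
  then show ?thesis
    using True j t le[of u] le[of t] by (auto simp: switch_time_def)
next
  case False
  then show ?thesis
    using mono_onD[OF mono, of u t] j t by (cases "t \<le> u") (auto simp: switch_time_def)
qed

text \<open>\<open>G\<close> is arbitrary because two instances matter: \<open>M\<close> itself, and
  the sigma-algebra generated by the counting process, which places the switching times on one side
  of the independence hypothesis.\<close>

lemma borel_measurable_switch_time:
  assumes N: "\<And>u. 0 \<le> u \<Longrightarrow> N u \<in> measurable G (count_space UNIV)"
    and mono: "\<And>\<omega>. \<omega> \<in> space G \<Longrightarrow> mono_on {0..} (\<lambda>u. N u \<omega>)"
    and cont: "\<And>\<omega> u. \<omega> \<in> space G \<Longrightarrow> 0 \<le> u \<Longrightarrow> continuous (at_right u) (\<lambda>u. N u \<omega>)"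
    and t: "0 \<le> t"
  shows "switch_time N t j \<in> borel_measurable G"
proof (cases "j = 0")
  case False
  have "{\<omega> \<in> space G. switch_time N t j \<omega> \<le> u} \<in> sets G" for u
  proof -
    have le: "switch_time N t j \<omega> \<le> u \<longleftrightarrow> t \<le> u \<or> 0 \<le> u \<and> j \<le> N u \<omega>" if "\<omega> \<in> space G" for \<omega>
      using False by (intro switch_time_le_iff mono cont t that) auto
    consider "t \<le> u" | "\<not> t \<le> u" "0 \<le> u" | "\<not> t \<le> u" "\<not> 0 \<le> u" by blast
    then show ?thesis
    proof cases
      case 1
      then have "{\<omega> \<in> space G. switch_time N t j \<omega> \<le> u} = space G" using le by blast
      then show ?thesis by (simp only: sets.top)
    next
      case 2
      then have "{\<omega> \<in> space G. switch_time N t j \<omega> \<le> u} = N u -` {j..} \<inter> space G" using le by auto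
      also have "\<dots> \<in> sets G" using N[OF 2(2)] by (rule measurable_sets) simp
      finally show ?thesis .
    next
      case 3
      then have "{\<omega> \<in> space G. switch_time N t j \<omega> \<le> u} = {}" using le by blast
      then show ?thesis by (simp only: sets.empty_sets)
    qed
  qed
  then show ?thesis by (intro borel_measurable_iff_le[THEN iffD2] allI)
qed (simp add: switch_time_def[abs_def])

section \<open>Poisson increments along a grid of times\<close>

lemma prod_power_mod_2:
  fixes f :: "nat \<Rightarrow> real"
  shows "(\<Prod>i<2 * m + 1. f i ^ (i mod 2)) = (\<Prod>i<m. f (2 * i + 1))"
  by (induction m) simp_all

text \<open>The Poisson law is extended to u = v, which occurs when consecutive intervals touch; the
  formula then reads 0^k / k!, with 0^0 = 1 the correct value.\<close>

lemma (in prob_space) poisson_process_increment_prob: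
  assumes "poisson_process M rate N" "0 < rate" "0 \<le> u" "u \<le> v"
  shows "prob ((\<lambda>\<omega>. N v \<omega> - N u \<omega>) -` {k} \<inter> space M) =
    (rate * (v - u)) ^ k / fact k * exp (- (rate * (v - u)))"
proof (cases "u = v")
  case True
  then show ?thesis by (cases k) (auto simp: prob_space)
next
  case False
  have [measurable]: "N u \<in> measurable M (count_space UNIV)" "N v \<in> measurable M (count_space UNIV)"
    using assms by (auto simp: poisson_process_def)
  have "distr M (count_space UNIV) (\<lambda>\<omega>. N v \<omega> - N u \<omega>) = measure_pmf (poisson_pmf (rate * (v - u)))"
    using assms False by (auto simp: poisson_process_def)
  then have "measure (distr M (count_space UNIV) (\<lambda>\<omega>. N v \<omega> - N u \<omega>)) {k} = pmf (poisson_pmf (rate * (v - u))) k"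
    by (simp add: measure_pmf_single)
  then show ?thesis
    using assms False by (simp add: measure_distr)
qed

text \<open>With \<open>N 0 = 0\<close>, the event says that the increments of \<open>N\<close> along
  \<open>0, a\<^sub>0, b\<^sub>0, a\<^sub>1, b\<^sub>1, \<dots>, t\<close> are \<open>0, 1, 0, 1, \<dots>, 0\<close>.\<close>

lemma (in prob_space) poisson_process_switch_times_in_box:
  fixes a b :: "nat \<Rightarrow> real"
  assumes N: "poisson_process M rate N" and rate: "0 < rate" and t: "0 < t"
    and ab: "\<And>i. i < n \<Longrightarrow> (if i = 0 then 0 else b (i - 1)) \<le> a i"
      "\<And>i. i < n \<Longrightarrow> a i < b i" "\<And>i. i < n \<Longrightarrow> b i < t"
  shows "prob {\<omega> \<in> space M. N t \<omega> = n \<and> (\<forall>i<n. switch_time N t (Suc i) \<omega> \<in> {a i<..b i})} =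
    rate ^ n * exp (- (rate * t)) * (\<Prod>i<n. b i - a i)"
proof -
  \<comment> \<open>The grid 0, a 0, b 0, ..., a (n - 1), b (n - 1), t, continued by the constant
    \<open>t\<close> so that \<open>r\<close> is monotone on all of \<open>nat\<close>, as
    \<open>poisson_process\<close> demands.\<close>
  define r where "r j = (if j = 0 then 0 else if 2 * n < j then t
      else if odd j then a (j div 2) else b ((j - 1) div 2))" for j
  have r0: "r 0 = 0" and r_last: "r (2 * n + 1) = t"
    by (auto simp: r_def)
  have r_odd: "r (2 * i + 1) = a i" and r_even: "r (2 * i + 2) = b i" if "i < n" for i
    using that by (auto simp: r_def)
  have r_Suc: "r j \<le> r (Suc j)" for j
  proof -
    consider "j = 0" | "j > 2 * n" | i where "j = 2 * i + 1" "i < n" | i where "j = 2 * i + 2" "i < n"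
    proof -
      have "\<exists>i<n. j = 2 * i + 1 \<or> j = 2 * i + 2" if "j \<noteq> 0" "j \<le> 2 * n"
      proof (cases "odd j")
        case True
        then obtain i where "j = 2 * i + 1" by (elim oddE)
        then show ?thesis using that by (intro exI[of _ i]) simp
      next
        case False
        then obtain k where "j = 2 * k" by (auto elim: evenE)
        then show ?thesis using that by (intro exI[of _ "k - 1"]) auto
      qed
      then have "j = 0 \<or> j > 2 * n \<or> (\<exists>i<n. j = 2 * i + 1) \<or> (\<exists>i<n. j = 2 * i + 2)"
        by (cases "j = 0 \<or> 2 * n < j") auto
      then show thesis using that by blast
    qed
    then show ?thesis
    proof cases
      case 1
      then show ?thesis using ab(1)[of 0] r0 r_odd[of 0] r_last t by (cases "n = 0") auto
    next
      case 2
      then show ?thesis by (simp add: r_def)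
    next
      case (3 i)
      then show ?thesis using r_odd[of i] r_even[of i] ab(2)[of i] by simp
    next
      case (4 i)
      show ?thesis
      proof (cases "Suc i < n")
        case True
        then show ?thesis using 4 r_even[of i] r_odd[of "Suc i"] ab(1)[of "Suc i"] by simp
      next
        case False
        then have "Suc j = 2 * n + 1" using 4 by simp
        then show ?thesis using 4 r_even[of i] r_last ab(3)[of i] by simp
      qed
    qed
  qed
  then have "mono r" by (simp add: mono_iff_le_Suc)
  then have r_nonneg: "0 \<le> r j" for j using r0 monoD[of r 0 j] by simp
  define D where "D j \<omega> = N (r (Suc j)) \<omega> - N (r j) \<omega>" for j \<omega>
  have "N t \<omega> = n \<and> (\<forall>i<n. switch_time N t (Suc i) \<omega> \<in> {a i<..b i}) \<longleftrightarrow>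
      (\<forall>j<2 * n + 1. D j \<omega> = j mod 2)" if \<omega>: "\<omega> \<in> space M" for \<omega>
  proof -
    have path: "N 0 \<omega> = 0" "mono_on {0..} (\<lambda>u. N u \<omega>)"
      "\<And>u. 0 \<le> u \<Longrightarrow> continuous (at_right u) (\<lambda>u. N u \<omega>)"
      using N \<omega> by (auto simp: poisson_process_def)
    have Nr: "N (r i) \<omega> \<le> N (r j) \<omega>" if "i \<le> j" for i j
      using mono_onD[OF path(2), of "r i" "r j"] r_nonneg monoD[OF \<open>mono r\<close> that] by simp
    have "switch_time N t (Suc i) \<omega> \<in> {a i<..b i} \<longleftrightarrow> N (a i) \<omega> \<le> i \<and> Suc i \<le> N (b i) \<omega>" if "i < n" for i
    proof -
      have "0 \<le> a i" "0 \<le> b i" "a i < t" "b i < t"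
        using r_nonneg[of "2 * i + 1"] r_odd[OF that] ab(2,3)[OF that] by simp_all
      then have "switch_time N t (Suc i) \<omega> \<le> a i \<longleftrightarrow> Suc i \<le> N (a i) \<omega>"
        "switch_time N t (Suc i) \<omega> \<le> b i \<longleftrightarrow> Suc i \<le> N (b i) \<omega>"
        using switch_time_le_iff[where N = N and \<omega> = \<omega> and t = t and j = "Suc i", OF path(2,3)] t by auto
      then show ?thesis
        unfolding greaterThanAtMost_iff not_le[symmetric] by auto
    qed
    then have "N t \<omega> = n \<and> (\<forall>i<n. switch_time N t (Suc i) \<omega> \<in> {a i<..b i}) \<longleftrightarrow>
      N t \<omega> = n \<and> (\<forall>i<n. N (a i) \<omega> \<le> i \<and> Suc i \<le> N (b i) \<omega>)" by auto
    \<comment> \<open>The chain i <= N(r(2i)) <= N(r(2i+1)) <= i squeezes the count to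
      \<open>j div 2\<close> at every grid point.\<close>
    also have "\<dots> \<longleftrightarrow> (\<forall>j\<le>2 * n + 1. N (r j) \<omega> = j div 2)"
    proof (intro iffI allI impI)
      assume *: "N t \<omega> = n \<and> (\<forall>i<n. N (a i) \<omega> \<le> i \<and> Suc i \<le> N (b i) \<omega>)"
      then have oddle: "N (r (2 * i + 1)) \<omega> \<le> i" if "i \<le> n" for i
        using that r_last r_odd[of i] by (cases "i = n") auto
      from * have evenge: "i \<le> N (r (2 * i)) \<omega>" if "i \<le> n" for i
        using that r_even[of "i - 1"] by (cases i) auto
      fix j assume j: "j \<le> 2 * n + 1"
      then have "j div 2 \<le> n" by simp
      from oddle[OF this] evenge[OF this] have "N (r (2 * (j div 2) + 1)) \<omega> \<le> j div 2" "j div 2 \<le> N (r (2 * (j div 2))) \<omega>" .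
      moreover have "N (r j) \<omega> \<le> N (r (2 * (j div 2) + 1)) \<omega>" "N (r (2 * (j div 2))) \<omega> \<le> N (r j) \<omega>"
        by (intro Nr; simp)+
      ultimately show "N (r j) \<omega> = j div 2" by simp
    next
      assume *: "\<forall>j\<le>2 * n + 1. N (r j) \<omega> = j div 2"
      have "N (a i) \<omega> \<le> i \<and> Suc i \<le> N (b i) \<omega>" if "i < n" for i
        using *[rule_format, of "2 * i + 1"] *[rule_format, of "2 * i + 2"] that
          r_odd[OF that] r_even[OF that] by simp
      moreover have "N t \<omega> = n" using *[rule_format, of "2 * n + 1"] r_last by simp
      ultimately show "N t \<omega> = n \<and> (\<forall>i<n. N (a i) \<omega> \<le> i \<and> Suc i \<le> N (b i) \<omega>)" by simp
    qed
    also have "\<dots> \<longleftrightarrow> (\<forall>j<2 * n + 1. D j \<omega> = j mod 2)"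
    proof (intro iffI allI impI)
      fix j assume *: "\<forall>j\<le>2 * n + 1. N (r j) \<omega> = j div 2" and "j < 2 * n + 1"
      then have "D j \<omega> = Suc j div 2 - j div 2" by (simp add: D_def)
      then show "D j \<omega> = j mod 2" by (cases "even j") (auto elim!: evenE oddE)
    next
      fix j assume *: "\<forall>j<2 * n + 1. D j \<omega> = j mod 2" and "j \<le> 2 * n + 1"
      from this(2) show "N (r j) \<omega> = j div 2"
      proof (induction j)
        case 0
        then show ?case using path(1) r0 by simp
      next
        case (Suc j)
        then have "D j \<omega> = j mod 2" "N (r j) \<omega> = j div 2" using * by auto
        then have "N (r (Suc j)) \<omega> = j div 2 + j mod 2"
          using Nr[of j "Suc j"] by (simp add: D_def)
        then show ?case by (cases "even j") (auto elim!: evenE oddE)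
      qed
    qed
    finally show ?thesis .
  qed
  then have "{\<omega> \<in> space M. N t \<omega> = n \<and> (\<forall>i<n. switch_time N t (Suc i) \<omega> \<in> {a i<..b i})} =
      (\<Inter>j\<in>{..<2 * n + 1}. D j -` {j mod 2} \<inter> space M)"
    by auto
  moreover have "indep_vars (\<lambda>_. count_space UNIV) D {..<2 * n + 1}"
    using N \<open>mono r\<close> r0 unfolding poisson_process_def D_def[abs_def] by simp
  then have "prob (\<Inter>j\<in>{..<2 * n + 1}. D j -` {j mod 2} \<inter> space M) =
      (\<Prod>j<2 * n + 1. prob (D j -` {j mod 2} \<inter> space M))"
    by (rule indep_varsD_finite) auto
  \<comment> \<open>As \<open>j mod 2\<close> is 0 or 1, the factorial in the Poisson weight is 1.
    Every grid cell contributes an exponential, the odd ones also rate times length.\<close>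
  moreover have "prob (D j -` {j mod 2} \<inter> space M) =
      (rate * (r (Suc j) - r j)) ^ (j mod 2) * exp (- (rate * (r (Suc j) - r j)))" for j
    unfolding D_def poisson_process_increment_prob[OF N rate r_nonneg r_Suc]
    by (cases "even j") (auto simp: odd_iff_mod_2_eq_one)
  moreover have "(\<Prod>j<2 * n + 1. exp (- (rate * (r (Suc j) - r j)))) = exp (- (rate * t))"
    using sum_lessThan_telescope[of r "2 * n + 1"] r0 r_last
    by (simp only: exp_sum[symmetric] finite_lessThan sum_negf sum_distrib_left[symmetric] diff_0_right)
  moreover have "(\<Prod>j<2 * n + 1. (rate * (r (Suc j) - r j)) ^ (j mod 2)) = (\<Prod>i<n. rate * (b i - a i))"
    unfolding prod_power_mod_2 using r_odd r_even by (intro prod.cong) auto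
  ultimately show ?thesis
    by (simp add: prod.distrib del: prod.lessThan_Suc)
qed

section \<open>The joint law of the switching times\<close>

definition ordered_boxes :: "nat \<Rightarrow> real \<Rightarrow> (nat \<Rightarrow> real) set set" where
  "ordered_boxes n t = {Pi\<^sub>E {0..<n} (\<lambda>i. {a i<..b i}) | a b.
    \<forall>i<n. (if i = 0 then 0 else b (i - 1)) \<le> a i \<and> b i < t}"

lemma ordered_boxesI:
  "(\<And>i. i < n \<Longrightarrow> (if i = 0 then 0 else b (i - 1)) \<le> a i \<and> b i < t) \<Longrightarrow>
    Pi\<^sub>E {0..<n} (\<lambda>i. {a i<..b i}) \<in> ordered_boxes n t"
  unfolding ordered_boxes_def by blast

lemma Int_stable_ordered_boxes: "Int_stable (ordered_boxes n t)"
proof (rule Int_stableI)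
  fix X Y assume "X \<in> ordered_boxes n t" "Y \<in> ordered_boxes n t"
  then obtain a b a' b' where
    X: "X = Pi\<^sub>E {0..<n} (\<lambda>i. {a i<..b i})" "\<And>i. i < n \<Longrightarrow> (if i = 0 then 0 else b (i - 1)) \<le> a i \<and> b i < t"
    and Y: "Y = Pi\<^sub>E {0..<n} (\<lambda>i. {a' i<..b' i})" "\<And>i. i < n \<Longrightarrow> (if i = 0 then 0 else b' (i - 1)) \<le> a' i \<and> b' i < t"
    unfolding ordered_boxes_def by blast
  have "X \<inter> Y = Pi\<^sub>E {0..<n} (\<lambda>i. {max (a i) (a' i)<..min (b i) (b' i)})"
    unfolding X(1) Y(1) PiE_Int Int_greaterThanAtMost ..
  also have "\<dots> \<in> ordered_boxes n t"
  proof (rule ordered_boxesI)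
    fix i assume "i < n"
    then show "(if i = 0 then 0 else min (b (i - 1)) (b' (i - 1))) \<le> max (a i) (a' i) \<and> min (b i) (b' i) < t"
      using X(2)[of i] Y(2)[of i] by (auto simp: min_le_iff_disj le_max_iff_disj split: if_splits)
  qed
  finally show "X \<inter> Y \<in> ordered_boxes n t" .
qed

lemma ordered_boxes_subset: "ordered_boxes n t \<subseteq> Pow (open_order_simplex 0 n 0 t)"
proof
  fix X assume "X \<in> ordered_boxes n t"
  then obtain a b where
    X: "X = Pi\<^sub>E {0..<n} (\<lambda>i. {a i<..b i})" "\<And>i. i < n \<Longrightarrow> (if i = 0 then 0 else b (i - 1)) \<le> a i \<and> b i < t"
    unfolding ordered_boxes_def by blast
  have "x \<in> open_order_simplex 0 n 0 t" if "x \<in> X" for x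
  proof -
    have x: "a i < x i" "x i \<le> b i" if "i < n" for i
      using \<open>x \<in> X\<close> that unfolding X(1) by (auto simp: PiE_iff)
    have "(if i = 0 then 0 else x (i - 1)) < x i \<and> x i < t" if "i < n" for i
      using x[of i] x[of "i - 1"] X(2)[OF that] that by (cases i) auto
    moreover have "x \<in> {0..<n} \<rightarrow>\<^sub>E UNIV" using \<open>x \<in> X\<close> unfolding X(1) by (auto simp: PiE_iff)
    ultimately show ?thesis by (simp add: open_order_simplex_def)
  qed
  then show "X \<in> Pow (open_order_simplex 0 n 0 t)" by blast
qed

lemma sets_ordered_boxes: "X \<in> ordered_boxes n t \<Longrightarrow> X \<in> sets (PiM {0..<n} (\<lambda>_. borel))"
  unfolding ordered_boxes_def by (auto intro!: sets_PiM_I_finite)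

text \<open>A point of the open simplex leaves room for rational endpoints between neighbouring
  coordinates. The bound \<open>q\<close> has two uses: constantly \<open>t\<close>, it exhausts the
  simplex; with one value changed, it yields the sublevel sets of a coordinate.\<close>

lemma open_order_simplex_countable_cover:
  fixes q :: "nat \<Rightarrow> real"
  obtains C where "countable C" "C \<subseteq> ordered_boxes n t"
    "\<Union>C = {x \<in> open_order_simplex 0 n 0 t. \<forall>i<n. x i < q i}"
proof
  let ?I = "{0..<n}"
  let ?ok = "\<lambda>(a, b). \<forall>i<n. (if i = 0 then 0 else b (i - 1)) \<le> a i \<and> b i < t \<and> b i < q i"
  define P where "P = {p \<in> (?I \<rightarrow>\<^sub>E \<rat>) \<times> (?I \<rightarrow>\<^sub>E \<rat>). ?ok p}"
  define C where "C = (\<lambda>(a, b). Pi\<^sub>E ?I (\<lambda>i. {a i<..b i})) ` P"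
  have "countable ((?I \<rightarrow>\<^sub>E \<rat>) \<times> (?I \<rightarrow>\<^sub>E (\<rat> :: real set)))"
    by (intro countable_SIGMA countable_PiE countable_rat) auto
  then have "countable P" unfolding P_def by (rule countable_subset[rotated]) auto
  then show "countable C" unfolding C_def by (rule countable_image)
  show sub: "C \<subseteq> ordered_boxes n t"
    unfolding C_def P_def by (auto intro!: ordered_boxesI split: if_splits)
  show "\<Union>C = {x \<in> open_order_simplex 0 n 0 t. \<forall>i<n. x i < q i}"
  proof (intro equalityI subsetI)
    fix x assume x: "x \<in> \<Union>C"
    then have "x \<in> open_order_simplex 0 n 0 t" using sub ordered_boxes_subset[of n t] by blast
    moreover obtain a b where ab: "x \<in> Pi\<^sub>E ?I (\<lambda>i. {a i<..b i})" "?ok (a, b)"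
      using x unfolding C_def P_def by auto
    have "x i < q i" if "i < n" for i
    proof -
      have "x i \<in> {a i<..b i}" using ab(1) that by (auto simp: PiE_iff)
      moreover have "b i < q i" using ab(2) that by simp
      ultimately show ?thesis by simp
    qed
    ultimately show "x \<in> {x \<in> open_order_simplex 0 n 0 t. \<forall>i<n. x i < q i}" by simp
  next
    fix x assume "x \<in> {x \<in> open_order_simplex 0 n 0 t. \<forall>i<n. x i < q i}"
    then have x: "x \<in> ?I \<rightarrow>\<^sub>E UNIV" "\<And>i. i < n \<Longrightarrow> x i < q i" "\<And>i. i < n \<Longrightarrow> x i < t"
      "\<And>i. i < n \<Longrightarrow> (if i = 0 then 0 else x (i - 1)) < x i"
      by (auto simp: open_order_simplex_def)
    \<comment> \<open>Right endpoints come first, each below the next coordinate or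
      \<open>t\<close>; each left endpoint then fits between the previous right endpoint and
      \<open>x i\<close>.\<close>
    have "\<exists>r\<in>\<rat>. x i < r \<and> r < min (q i) (if Suc i < n then x (Suc i) else t)" if "i < n" for i
      using x(2,3)[OF that] x(4)[of "Suc i"] by (intro Rats_dense_in_real) auto
    then obtain b where b: "\<And>i. i < n \<Longrightarrow> b i \<in> \<rat> \<and> x i < b i \<and> b i < min (q i) (if Suc i < n then x (Suc i) else t)"
      by metis
    have "\<exists>r\<in>\<rat>. (if i = 0 then 0 else b (i - 1)) < r \<and> r < x i" if "i < n" for i
      using x(4)[OF that] b[of "i - 1"] that by (intro Rats_dense_in_real) (auto split: if_splits)
    then obtain a where a: "\<And>i. i < n \<Longrightarrow> a i \<in> \<rat> \<and> (if i = 0 then 0 else b (i - 1)) < a i \<and> a i < x i"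
      by metis
    have bt: "b i < t" if "i < n" for i
      using b[OF that] x(3)[of "Suc i"] by (auto split: if_splits)
    have le_a: "(if i = 0 then 0 else b (i - 1)) \<le> a i" if "i < n" for i
      using a[OF that] by simp
    have a_ge: "0 < n \<Longrightarrow> 0 \<le> a 0" "\<And>i. i < n \<Longrightarrow> 0 < i \<Longrightarrow> b (i - Suc 0) \<le> a i"
      using le_a[of 0] le_a by (simp, fastforce)
    \<comment> \<open>Restriction makes the endpoint functions extensional, hence members of a
      countable product of rationals.\<close>
    have "(restrict a ?I, restrict b ?I) \<in> P"
      unfolding P_def using a b bt a_ge by (auto simp: less_imp_le split: if_splits)
    moreover have "x \<in> Pi\<^sub>E ?I (\<lambda>i. {restrict a ?I i<..restrict b ?I i})"
      using x(1) a b by (auto simp: PiE_iff less_imp_le)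
    ultimately show "x \<in> \<Union>C" 
      unfolding C_def by (intro UN_I[of "(restrict a ?I, restrict b ?I)"]) (simp_all only: prod.case)
  qed
qed

text \<open>The product sigma-algebra is generated by the coordinates, whose sublevel sets in the
  simplex are countable unions of ordered boxes; conversely each box is measurable.\<close>

lemma sets_restrict_open_order_simplex:
  "sets (restrict_space (PiM {0..<n} (\<lambda>_. borel)) (open_order_simplex 0 n 0 t)) =
    sigma_sets (open_order_simplex 0 n 0 t) (ordered_boxes n t)"
proof (intro equalityI subsetI)
  let ?D = "open_order_simplex 0 n 0 t" and ?I = "{0..<n}"
  define S where "S = sigma ?D (ordered_boxes n t)"
  have S: "space S = ?D" "sets S = sigma_sets ?D (ordered_boxes n t)"
    using ordered_boxes_subset[of n t] by (auto simp: S_def)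
  have D: "?D \<subseteq> ?I \<rightarrow>\<^sub>E UNIV" by (auto simp: open_order_simplex_def)
  have "(\<lambda>x. x i) \<in> borel_measurable S" if "i \<in> ?I" for i
  proof (rule borel_measurableI_less)
    fix c :: real
    \<comment> \<open>All coordinates are below \<open>t\<close> on the simplex, so only the bound
      \<open>c\<close> on coordinate \<open>i\<close> restricts.\<close>
    obtain C where C: "countable C" "C \<subseteq> ordered_boxes n t"
      "\<Union>C = {x \<in> ?D. \<forall>j<n. x j < ((\<lambda>_. t)(i := c)) j}"
      by (rule open_order_simplex_countable_cover)
    have "{x \<in> space S. x i < c} = \<Union>C"
      unfolding C(3) S using that by (auto simp: open_order_simplex_def)
    moreover have "\<Union>C \<in> sets S"
      using C(1,2) unfolding S by (intro sigma_sets_UNION) auto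
    ultimately show "{x \<in> space S. x i < c} \<in> sets S" by simp
  qed
  then have "(\<lambda>x i. x i) \<in> measurable S (PiM ?I (\<lambda>_. borel))"
    using D by (intro measurable_PiM_single') (auto simp: S)
  from measurable_sets[OF this]
  have *: "E \<inter> ?D \<in> sets S" if "E \<in> sets (PiM ?I (\<lambda>_. borel))" for E
    using that by (simp add: S)
  fix E assume "E \<in> sets (restrict_space (PiM ?I (\<lambda>_. borel)) ?D)"
  then show "E \<in> sigma_sets ?D (ordered_boxes n t)"
    using * S by (auto simp: sets_restrict_space Int_commute)
next
  let ?D = "open_order_simplex 0 n 0 t" and ?I = "{0..<n}"
  have D_sets: "?D \<in> sets (PiM ?I (\<lambda>_. borel))"
    using sets_open_order_simplex[of 0 n 0 t] by simp
  fix E assume "E \<in> sigma_sets ?D (ordered_boxes n t)"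
  then show "E \<in> sets (restrict_space (PiM ?I (\<lambda>_. borel)) ?D)"
  proof (rule sets.sigma_sets_subset'[THEN subsetD, rotated -1])
    show "ordered_boxes n t \<subseteq> sets (restrict_space (PiM ?I (\<lambda>_. borel)) ?D)"
      using ordered_boxes_subset[of n t] sets_ordered_boxes[of _ n t] D_sets
      by (auto simp: sets_restrict_space_iff)
    show "?D \<in> sets (restrict_space (PiM ?I (\<lambda>_. borel)) ?D)"
      using D_sets by (simp add: sets_restrict_space_iff)
  qed
qed

text \<open>Equality on ordered boxes only compares the two measures inside the simplex; that the
  switching times do not charge its complement follows from equality of the total masses.\<close>

lemma (in prob_space) poisson_process_switch_times_distr:
  assumes N: "poisson_process M rate N" and rate: "0 < rate" and t: "0 < t"
  shows "distr (density M (indicator {\<omega> \<in> space M. N t \<omega> = n})) (PiM {0..<n} (\<lambda>_. borel))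
      (\<lambda>\<omega>. \<lambda>i\<in>{0..<n}. switch_time N t (Suc i) \<omega>) =
    density (PiM {0..<n} (\<lambda>_. lborel))
      (\<lambda>x. ennreal (rate ^ n * exp (- (rate * t))) * indicator (open_order_simplex 0 n 0 t) x)"
    (is "?L = ?R")
proof -
  interpret L: product_sigma_finite "\<lambda>_ :: nat. lborel :: real measure" by standard
  let ?I = "{0..<n}" and ?D = "open_order_simplex 0 n 0 t"
  let ?A = "{\<omega> \<in> space M. N t \<omega> = n}"
  define \<mu> where "\<mu> = ?L"
  define \<eta> where "\<eta> = ?R"
  define c where "c = rate ^ n * exp (- (rate * t))"
  have c: "0 < c" using rate by (simp add: c_def)
  define S where "S \<omega> = (\<lambda>i\<in>?I. switch_time N t (Suc i) \<omega>)" for \<omega>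
  have N_meas: "N u \<in> measurable M (count_space UNIV)" if "0 \<le> u" for u
    using N that by (simp add: poisson_process_def)
  have [measurable]: "switch_time N t j \<in> borel_measurable M" for j
    using N t by (intro borel_measurable_switch_time) (auto simp: poisson_process_def)
  have S_meas [measurable]: "S \<in> measurable M (PiM ?I (\<lambda>_. borel))"
    unfolding S_def by measurable
  have A [measurable]: "?A \<in> sets M"
  proof -
    have "?A = N t -` {n} \<inter> space M" by auto
    also have "\<dots> \<in> sets M" using N_meas[of t] t by (intro measurable_sets) auto
    finally show ?thesis .
  qed
  have D [measurable]: "?D \<in> sets (PiM ?I (\<lambda>_. borel))"
    using sets_open_order_simplex[of 0 n 0 t] by simp
  have sets_eq: "sets (PiM ?I (\<lambda>_. lborel)) = sets (PiM ?I (\<lambda>_. borel :: real measure))"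
    by (simp cong: sets_PiM_cong)
  have sets_L: "sets \<mu> = sets (PiM ?I (\<lambda>_. borel))" and sets_R: "sets \<eta> = sets (PiM ?I (\<lambda>_. borel))"
    by (simp_all add: \<mu>_def \<eta>_def sets_eq)
  have L: "emeasure \<mu> E = emeasure M (S -` E \<inter> ?A)" if E: "E \<in> sets (PiM ?I (\<lambda>_. borel))" for E
  proof -
    have "emeasure \<mu> E = emeasure (density M (indicator ?A)) (S -` E \<inter> space M)"
      unfolding \<mu>_def S_def[symmetric] using E by (subst emeasure_distr) auto
    also have "\<dots> = (\<integral>\<^sup>+\<omega>. indicator (S -` E \<inter> ?A) \<omega> \<partial>M)"
      using E measurable_sets[OF S_meas E]
      by (subst emeasure_density) (auto intro!: nn_integral_cong simp: indicator_def)
    also have "\<dots> = emeasure M (S -` E \<inter> ?A)"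
    proof -
      have "S -` E \<inter> ?A = (S -` E \<inter> space M) \<inter> ?A" by auto
      also have "\<dots> \<in> sets M" using measurable_sets[OF S_meas E] A by (rule sets.Int)
      finally show ?thesis by simp
    qed
    finally show ?thesis .
  qed
  have R: "emeasure \<eta> E = ennreal c * emeasure (PiM ?I (\<lambda>_. lborel)) (E \<inter> ?D)"
    if E: "E \<in> sets (PiM ?I (\<lambda>_. borel))" for E
  proof -
    have "E \<inter> ?D \<in> sets (PiM ?I (\<lambda>_. lborel))" unfolding sets_eq using E D by (rule sets.Int)
    moreover have "emeasure \<eta> E = (\<integral>\<^sup>+x. ennreal c * indicator (E \<inter> ?D) x \<partial>PiM ?I (\<lambda>_. lborel))"
      using E D unfolding \<eta>_def c_def[symmetric] sets_eq[symmetric]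
      by (subst emeasure_density) (auto intro!: nn_integral_cong simp: indicator_def)
    ultimately show ?thesis by (simp add: nn_integral_cmult_indicator)
  qed
  have box: "emeasure \<mu> X = emeasure \<eta> X" if "X \<in> ordered_boxes n t" for X
  proof -
    obtain a b where X: "X = Pi\<^sub>E ?I (\<lambda>i. {a i<..b i})"
      and ab: "\<And>i. i < n \<Longrightarrow> (if i = 0 then 0 else b (i - 1)) \<le> a i \<and> b i < t"
      using \<open>X \<in> ordered_boxes n t\<close> unfolding ordered_boxes_def by blast
    note X_sets = sets_ordered_boxes[OF that]
    show ?thesis
    \<comment> \<open>The box probability is available for \<open>a i < b i\<close>; otherwise the
      box is empty.\<close>
    proof (cases "\<forall>i<n. a i < b i")
      case False
      then have "X = {}" unfolding X by (auto simp: PiE_eq_empty_iff)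
      then show ?thesis by simp
    next
      case True
      have "S -` X \<inter> ?A = {\<omega> \<in> space M. N t \<omega> = n \<and> (\<forall>i<n. switch_time N t (Suc i) \<omega> \<in> {a i<..b i})}"
        unfolding X S_def by (auto simp: PiE_iff)
      then have "emeasure \<mu> X = ennreal (c * (\<Prod>i<n. b i - a i))"
        using poisson_process_switch_times_in_box[OF N rate t, of n b a] ab True
        unfolding L[OF X_sets] c_def by (simp add: emeasure_eq_measure)
      moreover have "X \<inter> ?D = X" using ordered_boxes_subset[of n t] that by blast
      then have "emeasure \<eta> X = ennreal c * emeasure (PiM ?I (\<lambda>_. lborel)) X"
        using R[OF X_sets] by simp
      moreover have "emeasure (PiM ?I (\<lambda>_. lborel)) X = (\<Prod>i\<in>?I. emeasure lborel {a i<..b i})"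
        unfolding X by (rule L.emeasure_PiM) auto
      ultimately show ?thesis
        using prod_ennreal[of "{..<n}" "\<lambda>i. b i - a i"] True c
        by (simp add: ennreal_mult' less_imp_le atLeast0LessThan)
    qed
  qed
  \<comment> \<open>A countable cover by boxes of finite measure, as uniqueness on a generator
    requires.\<close>
  obtain C where C: "countable C" "C \<subseteq> ordered_boxes n t" "\<Union>C = {x \<in> ?D. \<forall>i<n. x i < t}"
    by (rule open_order_simplex_countable_cover)
  have "restrict_space \<mu> ?D = restrict_space \<eta> ?D"
  proof (rule measure_eqI_generator_eq_countable[OF Int_stable_ordered_boxes ordered_boxes_subset])
    show "C \<subseteq> ordered_boxes n t" "countable C" by fact+
    show "\<Union>C = ?D" unfolding C(3) by (auto simp: open_order_simplex_def)
    show "emeasure (restrict_space \<mu> ?D) X = emeasure (restrict_space \<eta> ?D) X"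
      if X: "X \<in> ordered_boxes n t" for X
    proof -
      have "X \<subseteq> ?D" using X ordered_boxes_subset[of n t] by blast
      then show ?thesis
        using D by (simp add: emeasure_restrict_space sets_L sets_R box[OF X])
    qed
    show "emeasure (restrict_space \<mu> ?D) X \<noteq> \<infinity>" if "X \<in> C" for X
    proof -
      have X: "X \<in> ordered_boxes n t" "X \<subseteq> ?D" using that C(2) ordered_boxes_subset[of n t] by auto
      then have "emeasure (restrict_space \<mu> ?D) X = emeasure \<mu> X"
        using D by (intro emeasure_restrict_space) (simp_all add: sets_L)
      then show ?thesis using L[OF sets_ordered_boxes[OF X(1)]] by simp
    qed
    show "sets (restrict_space \<mu> ?D) = sigma_sets ?D (ordered_boxes n t)"
      "sets (restrict_space \<eta> ?D) = sigma_sets ?D (ordered_boxes n t)"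
      unfolding sets_restrict_open_order_simplex[symmetric]
      by (simp_all only: sets_restrict_space sets_L sets_R)
  qed
  then have in_D: "emeasure \<mu> (E \<inter> ?D) = emeasure \<eta> (E \<inter> ?D)" if "E \<in> sets (PiM ?I (\<lambda>_. borel))" for E
    using that D emeasure_restrict_space[of ?D \<mu> "E \<inter> ?D"] emeasure_restrict_space[of ?D \<eta> "E \<inter> ?D"]
    by (simp add: sets_L sets_R)
  let ?O = "space (PiM ?I (\<lambda>_. borel :: real measure))"
  \<comment> \<open>The total mass is P(N(t) = n) = c t^n / n!, which is \<open>c\<close> times the
    volume of the simplex, so nothing is left for the complement.\<close>
  have "emeasure \<mu> ?O = emeasure M ((\<lambda>\<omega>. N t \<omega> - N 0 \<omega>) -` {n} \<inter> space M)"
  proof -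
    have "S -` ?O \<inter> ?A = (\<lambda>\<omega>. N t \<omega> - N 0 \<omega>) -` {n} \<inter> space M"
      using N measurable_space[OF S_meas] by (auto simp: poisson_process_def)
    then show ?thesis by (subst L) auto
  qed
  also have "\<dots> = ennreal (c * (t ^ n / fact n))"
    using poisson_process_increment_prob[OF N rate, of 0 t n] t
    by (simp add: emeasure_eq_measure c_def power_mult_distrib mult_ac)
  also have "\<dots> = ennreal c * ennreal (t ^ n / fact n)"
    using c ennreal_mult'[of c "t ^ n / fact n"] by (simp only: less_imp_le)
  also have "ennreal (t ^ n / fact n) = emeasure (PiM ?I (\<lambda>_. lborel)) ?D"
    using iterated_integral_eq_nn_integral[of 0 t "\<lambda>_. 1" 0 n 1] iterated_integral_const_1[of 0 t n] t D
    by (simp add: sets_eq)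
  also have "ennreal c * \<dots> = emeasure \<eta> ?D"
    by (subst R) (use D in auto)
  also have "\<dots> = emeasure \<mu> ?D"
    using in_D[of ?D] D by simp
  finally have *: "emeasure \<mu> ?O = emeasure \<mu> ?D" .
  have outside: "emeasure \<mu> (E - ?D) = 0" if E: "E \<in> sets (PiM ?I (\<lambda>_. borel))" for E
  proof -
    have "emeasure \<mu> (?O - ?D) = emeasure \<mu> ?O - emeasure \<mu> ?D"
      using D sets.sets_into_space[OF D] L[OF D] by (intro emeasure_Diff) (auto simp: sets_L)
    then have "emeasure \<mu> (?O - ?D) = 0"
      unfolding * using L[OF D] by simp
    moreover have "emeasure \<mu> (E - ?D) \<le> emeasure \<mu> (?O - ?D)"
      using E D sets.sets_into_space[OF E] by (intro emeasure_mono) (auto simp: sets_L)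
    ultimately show ?thesis by simp
  qed
  have "\<mu> = \<eta>"
  proof (rule measure_eqI)
    show "sets \<mu> = sets \<eta>" by (simp only: sets_L sets_R)
    fix E assume "E \<in> sets \<mu>"
    then have E: "E \<in> sets (PiM ?I (\<lambda>_. borel))" by (simp only: sets_L)
    have "emeasure \<mu> E = emeasure \<mu> (E \<inter> ?D) + emeasure \<mu> (E - ?D)"
      using E D by (subst plus_emeasure) (auto simp: sets_L Int_Diff_Un)
    also have "\<dots> = emeasure \<eta> (E \<inter> ?D)"
      using in_D[OF E] outside[OF E] by simp
    also have "\<dots> = emeasure \<eta> E"
      using R[OF E] R[of "E \<inter> ?D"] E D by (simp add: Int_assoc)
    finally show "emeasure \<mu> E = emeasure \<eta> E" .
  qed
  then show ?thesis unfolding \<mu>_def \<eta>_def .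
qed

section \<open>The conditional moment generating function\<close>

text \<open>A switching time is a functional of the path, so independence is used at the level of
  sigma-algebras: variables measurable for \<open>F\<close> and \<open>G\<close> have a product law,
  and Tonelli freezes one while the other is averaged.\<close>

lemma (in prob_space) nn_integral_indep_set:
  assumes indep: "indep_set (sets F) (sets G)"
    and space: "space F = space M" "space G = space M"
    and X: "X \<in> measurable F S" and Y: "Y \<in> measurable G T"
    and f [measurable]: "f \<in> borel_measurable (S \<Otimes>\<^sub>M T)"
  shows "(\<integral>\<^sup>+\<omega>. f (X \<omega>, Y \<omega>) \<partial>M) = (\<integral>\<^sup>+\<omega>. \<integral>\<^sup>+y. f (X \<omega>, y) \<partial>distr M T Y \<partial>M)"
proof -
  have F: "sets F \<subseteq> events" and G: "sets G \<subseteq> events"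
    using indep by (rule indep_setD_ev1, rule indep_setD_ev2)
  have XM [measurable]: "X \<in> measurable M S" and YM [measurable]: "Y \<in> measurable M T"
    using measurable_mono[OF order_refl refl F space(1)] X
      measurable_mono[OF order_refl refl G space(2)] Y by auto
  interpret X: prob_space "distr M S X" by (rule prob_space_distr) (rule XM)
  interpret Y: prob_space "distr M T Y" by (rule prob_space_distr) (rule YM)
  have eq: "distr M S X \<Otimes>\<^sub>M distr M T Y = distr M (S \<Otimes>\<^sub>M T) (\<lambda>\<omega>. (X \<omega>, Y \<omega>))"
  proof (rule pair_measure_eqI)
    show "sigma_finite_measure (distr M S X)" "sigma_finite_measure (distr M T Y)"
      by unfold_locales
    show "sets (distr M S X \<Otimes>\<^sub>M distr M T Y) = sets (distr M (S \<Otimes>\<^sub>M T) (\<lambda>\<omega>. (X \<omega>, Y \<omega>)))"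
      by (simp cong: sets_pair_measure_cong)
    fix A B assume "A \<in> sets (distr M S X)" "B \<in> sets (distr M T Y)"
    then have A: "A \<in> sets S" and B: "B \<in> sets T" by simp_all
    have "(\<lambda>\<omega>. (X \<omega>, Y \<omega>)) -` (A \<times> B) \<inter> space M = (X -` A \<inter> space F) \<inter> (Y -` B \<inter> space G)"
      unfolding space by auto
    moreover have "prob ((X -` A \<inter> space F) \<inter> (Y -` B \<inter> space G)) =
        prob (X -` A \<inter> space F) * prob (Y -` B \<inter> space G)"
      using measurable_sets[OF X A] measurable_sets[OF Y B] by (rule indep_setD[OF indep])
    ultimately show "emeasure (distr M S X) A * emeasure (distr M T Y) B =
        emeasure (distr M (S \<Otimes>\<^sub>M T) (\<lambda>\<omega>. (X \<omega>, Y \<omega>))) (A \<times> B)"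
      using A B by (simp add: emeasure_distr space emeasure_eq_measure ennreal_mult)
  qed
  have "(\<integral>\<^sup>+\<omega>. f (X \<omega>, Y \<omega>) \<partial>M) = (\<integral>\<^sup>+p. f p \<partial>distr M (S \<Otimes>\<^sub>M T) (\<lambda>\<omega>. (X \<omega>, Y \<omega>)))"
    by (subst nn_integral_distr) auto
  also have "\<dots> = (\<integral>\<^sup>+x. \<integral>\<^sup>+y. f (x, y) \<partial>distr M T Y \<partial>distr M S X)"
    unfolding eq[symmetric] by (subst Y.nn_integral_fst[symmetric]) auto
  also have "\<dots> = (\<integral>\<^sup>+\<omega>. \<integral>\<^sup>+y. f (X \<omega>, y) \<partial>distr M T Y \<partial>M)"
    by (subst nn_integral_distr) auto
  finally show ?thesis .
qed

text \<open>Counted from 0, gap \<open>j\<close> is s_(j+1) - s_j with s_0 = 0 and s_(n+1) = t. It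
  is the common form of two encodings: the list in the integrand, and the differences of
  \<open>switch_time\<close> in the motion.\<close>

definition switch_gap :: "nat \<Rightarrow> real \<Rightarrow> (nat \<Rightarrow> real) \<Rightarrow> nat \<Rightarrow> real" where
  "switch_gap n t x j = (if j < n then x j else t) - (if j = 0 then 0 else x (j - 1))"

lemma borel_measurable_switch_gap [measurable]:
  assumes "j \<le> n"
  shows "(\<lambda>x. switch_gap n t x j) \<in> borel_measurable (PiM {0..<n} (\<lambda>_. borel))"
proof -
  have "(\<lambda>x. if j < n then x j else t) \<in> borel_measurable (PiM {0..<n} (\<lambda>_. borel))"
    by (cases "j < n") auto
  moreover have "(\<lambda>x. if j = 0 then 0 else x (j - 1)) \<in> borel_measurable (PiM {0..<n} (\<lambda>_. borel :: real measure))"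
    using assms by (cases j) auto
  ultimately show ?thesis unfolding switch_gap_def by simp
qed

lemma prod_list_gaps_eq_switch_gap:
  "(let s = 0 # map x [0..<n] @ [t] in \<Prod>j = 1..n + 1. f (s ! j - s ! (j - 1))) =
    (\<Prod>j<Suc n. f (switch_gap n t x j))"
proof -
  have "(let s = 0 # map x [0..<n] @ [t] in \<Prod>j = 1..n + 1. f (s ! j - s ! (j - 1))) =
    (\<Prod>j<Suc n. f ((map x [0..<n] @ [t]) ! j - (0 # map x [0..<n] @ [t]) ! j))"
    unfolding Let_def Suc_eq_plus1[symmetric] unfolding One_nat_def prod.atLeast1_atMost_eq
    by (simp only: nth_Cons_Suc diff_Suc_Suc diff_zero)
  also have "\<dots> = (\<Prod>j<Suc n. f (switch_gap n t x j))"
    by (intro prod.cong arg_cong[where f = f]) (auto simp: switch_gap_def nth_append nth_Cons split: nat.split)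
  finally show ?thesis .
qed

lemma random_motion_eq_switch_gap:
  assumes "N t \<omega> = n"
  shows "random_motion c N \<theta> t \<omega> =
    c * (\<Sum>j<Suc n. switch_gap n t (\<lambda>i\<in>{0..<n}. switch_time N t (Suc i) \<omega>) j * cos (\<theta> (Suc j) \<omega>))"
proof -
  have "switch_time N t (Suc j) \<omega> - switch_time N t j \<omega> =
      switch_gap n t (\<lambda>i\<in>{0..<n}. switch_time N t (Suc i) \<omega>) j" if "j < Suc n" for j
    using assms that by (auto simp: switch_gap_def switch_time_def)
  then show ?thesis
    unfolding random_motion_def assms Suc_eq_plus1[symmetric]
    unfolding One_nat_def sum.atLeast1_atMost_eq diff_Suc_Suc diff_zero
    by (intro arg_cong[where f = "(*) c"] sum.cong) auto
qed

section \<open>Averaging over the angles with the switching times frozen\<close>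

locale poisson_random_motion = prob_space M
  for M :: "'a measure" +
  fixes N :: "real \<Rightarrow> 'a \<Rightarrow> nat" and \<theta> :: "nat \<Rightarrow> 'a \<Rightarrow> real" and rate \<nu> t :: real
  assumes rate: "rate > 0" and \<nu>: "\<nu> \<ge> 0" and t: "t > 0"
    and N: "poisson_process M rate N"
    and \<theta>_distr: "\<And>j. j \<ge> 1 \<Longrightarrow> distributed M lborel (\<theta> j) (\<lambda>x. ennreal (angle_density \<nu> x))"
    and \<theta>_indep: "indep_vars (\<lambda>_. borel) \<theta> {1..}"
    and N_\<theta>_indep: "indep_set (generated_sigma M {0..} (count_space UNIV) N)
           (generated_sigma M {1..} borel \<theta>)"
begin

lemma measurable_N [measurable]: "0 \<le> u \<Longrightarrow> N u \<in> measurable M (count_space UNIV)"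
  using N by (simp add: poisson_process_def)

lemma measurable_\<theta> [measurable]: "\<theta> (Suc j) \<in> borel_measurable M"
  using distributed_measurable[OF \<theta>_distr[of "Suc j"]] by simp

lemma measurable_switch_time [measurable]: "switch_time N t j \<in> borel_measurable M"
  using N t by (intro borel_measurable_switch_time) (auto simp: poisson_process_def)

definition switch_vector :: "nat \<Rightarrow> 'a \<Rightarrow> nat \<Rightarrow> real" where
  "switch_vector n \<omega> = (\<lambda>i\<in>{0..<n}. switch_time N t (Suc i) \<omega>)"

definition angle_vector :: "nat \<Rightarrow> 'a \<Rightarrow> nat \<Rightarrow> real" where
  "angle_vector n \<omega> = (\<lambda>j\<in>{1..n}. \<theta> j \<omega>)"

lemma measurable_switch_vector [measurable]:
  "switch_vector n \<in> measurable M (PiM {0..<n} (\<lambda>_. borel))"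
  unfolding switch_vector_def[abs_def] by (intro measurable_restrict) simp

lemma nn_integral_switch_angle:
  assumes f: "f \<in> borel_measurable
    ((count_space UNIV \<Otimes>\<^sub>M PiM {0..<n} (\<lambda>_. borel)) \<Otimes>\<^sub>M PiM {1..m} (\<lambda>_. borel))"
  shows "(\<integral>\<^sup>+\<omega>. f ((N t \<omega>, switch_vector n \<omega>), angle_vector m \<omega>) \<partial>M) =
    (\<integral>\<^sup>+\<omega>. \<integral>\<^sup>+y. f ((N t \<omega>, switch_vector n \<omega>), y) \<partial>distr M (PiM {1..m} (\<lambda>_. borel)) (angle_vector m) \<partial>M)"
proof (rule nn_integral_indep_set[OF _ _ _ _ _ f])
  let ?F = "vimage_algebra (space M) (\<lambda>\<omega>. \<lambda>i\<in>{0..}. N i \<omega>) (PiM {0..} (\<lambda>_. count_space UNIV))"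
  let ?G = "vimage_algebra (space M) (\<lambda>\<omega>. \<lambda>i\<in>{1..}. \<theta> i \<omega>) (PiM {1..} (\<lambda>_. borel))"
  show "indep_set (sets ?F) (sets ?G)"
    using N_\<theta>_indep by (simp add: generated_sigma_def)
  have "(\<lambda>\<omega>. \<lambda>i\<in>{0..}. N i \<omega>) \<in> measurable ?F (PiM {0..} (\<lambda>_. count_space UNIV))"
    by (rule measurable_vimage_algebra1) (auto simp: space_PiM)
  from measurable_compose[OF this measurable_component_singleton]
  have NF: "N u \<in> measurable ?F (count_space UNIV)" if "0 \<le> u" for u
    using that by fastforce
  then have sw: "switch_time N t j \<in> borel_measurable ?F" for j
    using N t by (intro borel_measurable_switch_time) (auto simp: poisson_process_def)
  have "switch_vector n \<in> measurable ?F (PiM {0..<n} (\<lambda>_. borel))"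
    unfolding switch_vector_def[abs_def] by (intro measurable_restrict sw)
  then show "(\<lambda>\<omega>. (N t \<omega>, switch_vector n \<omega>)) \<in> measurable ?F (count_space UNIV \<Otimes>\<^sub>M PiM {0..<n} (\<lambda>_. borel))"
    using NF[of t] t by (intro measurable_Pair) auto
  have "(\<lambda>\<omega>. \<lambda>i\<in>{1..}. \<theta> i \<omega>) \<in> measurable ?G (PiM {1..} (\<lambda>_. borel))"
    by (rule measurable_vimage_algebra1) (auto simp: space_PiM)
  from measurable_compose[OF this measurable_component_singleton]
  have "\<theta> j \<in> borel_measurable ?G" if "j \<in> {1..m}" for j
    using that by fastforce
  then show "angle_vector m \<in> measurable ?G (PiM {1..m} (\<lambda>_. borel))"
    unfolding angle_vector_def[abs_def] by (intro measurable_restrict)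
qed auto

lemma distr_angle: "j \<ge> 1 \<Longrightarrow> distr M borel (\<theta> j) = density lborel (\<lambda>x. ennreal (angle_density \<nu> x))"
  using distributed_distr_eq_density[OF \<theta>_distr[of j]]
  by (simp cong: distr_cong)

lemma distr_angle_vector:
  assumes "m \<ge> 1"
  shows "distr M (PiM {1..m} (\<lambda>_. borel)) (angle_vector m) =
    PiM {1..m} (\<lambda>_. density lborel (\<lambda>x. ennreal (angle_density \<nu> x)))"
proof -
  have "indep_vars (\<lambda>_. borel) \<theta> {1..m}"
    by (rule indep_vars_subset[OF \<theta>_indep]) auto
  moreover have "\<theta> j \<in> borel_measurable M" if "j \<in> {1..m}" for j
    using that measurable_\<theta>[of "j - 1"] by simp
  ultimately have "distr M (PiM {1..m} (\<lambda>_. borel)) (angle_vector m) = PiM {1..m} (\<lambda>j. distr M borel (\<theta> j))"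
    using assms unfolding angle_vector_def[abs_def]
    by (subst indep_vars_iff_distr_eq_PiM'[symmetric]) auto
  also have "\<dots> = PiM {1..m} (\<lambda>_. density lborel (\<lambda>x. ennreal (angle_density \<nu> x)))"
    by (intro PiM_cong distr_angle) auto
  finally show ?thesis .
qed

lemma prob_space_angle: "prob_space (density lborel (\<lambda>x. ennreal (angle_density \<nu> x)))"
  unfolding distr_angle[of "Suc 0", simplified, symmetric] by (rule prob_space_distr) simp

text \<open>By independence the exponential of the sum factors into single-angle integrals. Summands
  are counted from 0 and angles from 1, hence \<open>Suc j\<close>.\<close>

lemma nn_integral_exp_angle_vector:
  "(\<integral>\<^sup>+y. ennreal (exp (\<Sum>j<Suc n. z j * cos (y (Suc j))))
      \<partial>distr M (PiM {1..Suc n} (\<lambda>_. borel)) (angle_vector (Suc n))) =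
    ennreal (\<Prod>j<Suc n. 2 powr \<nu> * Gamma (\<nu> + 1) * bessel_I_quot \<nu> (z j))"
proof -
  let ?A = "density lborel (\<lambda>x. ennreal (angle_density \<nu> x))"
  let ?J = "{Suc 0..Suc n}"
  interpret A: prob_space ?A by (rule prob_space_angle)
  interpret product_sigma_finite "\<lambda>_ :: nat. ?A" by standard
  have "ennreal (exp (\<Sum>j<Suc n. z j * cos (y (Suc j)))) =
      (\<Prod>j\<in>?J. ennreal (exp (z (j - 1) * cos (y j))))" for y
    unfolding exp_sum[OF finite_lessThan] prod.atLeast1_atMost_eq
    by (subst prod_ennreal) (auto simp del: prod.lessThan_Suc)
  then have "(\<integral>\<^sup>+y. ennreal (exp (\<Sum>j<Suc n. z j * cos (y (Suc j)))) \<partial>PiM ?J (\<lambda>_. ?A)) =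
     (\<integral>\<^sup>+y. (\<Prod>j\<in>?J. ennreal (exp (z (j - 1) * cos (y j)))) \<partial>PiM ?J (\<lambda>_. ?A))"
    by (simp only:)
  also have "\<dots> = (\<Prod>j\<in>?J. \<integral>\<^sup>+x. ennreal (exp (z (j - 1) * cos x)) \<partial>?A)"
    by (rule product_nn_integral_prod[where f = "\<lambda>j x. ennreal (exp (z (j - 1) * cos x))"]) auto
  also have "\<dots> = (\<Prod>j<Suc n. ennreal (2 powr \<nu> * Gamma (\<nu> + 1) * bessel_I_quot \<nu> (z j)))"
    unfolding nn_integral_angle_density_mgf[OF \<nu> prob_space_angle] prod.atLeast1_atMost_eq diff_Suc_1 ..
  also have "\<dots> = ennreal (\<Prod>j<Suc n. 2 powr \<nu> * Gamma (\<nu> + 1) * bessel_I_quot \<nu> (z j))"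
    using \<nu> by (intro prod_ennreal mult_nonneg_nonneg bessel_I_quot_nonneg Gamma_real_nonneg) auto
  finally show ?thesis
    using distr_angle_vector[of "Suc n"] by (simp only: One_nat_def le_numeral_extra Suc_le_mono le0)
qed

lemma nn_integral_exp_random_motion:
  "(\<integral>\<^sup>+\<omega>. ennreal (exp (\<beta> * random_motion c N \<theta> t \<omega>)) * indicator {\<omega> \<in> space M. N t \<omega> = n} \<omega> \<partial>M) =
    (\<integral>\<^sup>+\<omega>. indicator {\<omega> \<in> space M. N t \<omega> = n} \<omega> * ennreal (\<Prod>j<Suc n. 2 powr \<nu> * Gamma (\<nu> + 1) *
      bessel_I_quot \<nu> (\<beta> * c * switch_gap n t (switch_vector n \<omega>) j)) \<partial>M)"
proof -
  \<comment> \<open>The indicator of \<open>k = n\<close> replaces the random number of summands by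
    the fixed number \<open>Suc n\<close>.\<close>
  define f :: "(nat \<times> (nat \<Rightarrow> real)) \<times> (nat \<Rightarrow> real) \<Rightarrow> ennreal" where
    "f = (\<lambda>((k, x), y). indicator {n} k *
      ennreal (exp (\<Sum>j<Suc n. (\<beta> * c * switch_gap n t x j) * cos (y (Suc j)))))"
  have g: "(\<lambda>p. \<Sum>j<Suc n. (\<beta> * c * switch_gap n t (snd (fst p)) j) * cos (snd p (Suc j)))
      \<in> borel_measurable ((count_space UNIV \<Otimes>\<^sub>M PiM {0..<n} (\<lambda>_. borel)) \<Otimes>\<^sub>M PiM {1..Suc n} (\<lambda>_. borel))"
  proof (rule borel_measurable_sum)
    fix j assume j: "j \<in> {..<Suc n}"
    then have [measurable]: "(\<lambda>x. switch_gap n t x j) \<in> borel_measurable (PiM {0..<n} (\<lambda>_. borel))"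
      by (intro borel_measurable_switch_gap) auto
    have [measurable]: "(\<lambda>y. y (Suc j)) \<in> borel_measurable (PiM {1..Suc n} (\<lambda>_. borel :: real measure))"
      using j by (intro measurable_component_singleton) auto
    show "(\<lambda>p. (\<beta> * c * switch_gap n t (snd (fst p)) j) * cos (snd p (Suc j)))
      \<in> borel_measurable ((count_space UNIV \<Otimes>\<^sub>M PiM {0..<n} (\<lambda>_. borel)) \<Otimes>\<^sub>M PiM {1..Suc n} (\<lambda>_. borel))"
      by measurable
  qed
  have f: "f \<in> borel_measurable ((count_space UNIV \<Otimes>\<^sub>M PiM {0..<n} (\<lambda>_. borel)) \<Otimes>\<^sub>M PiM {1..Suc n} (\<lambda>_. borel))"
    unfolding f_def case_prod_beta
    by (intro borel_measurable_times_ennreal measurable_compose[OF g]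
        measurable_compose[OF measurable_compose[OF measurable_fst measurable_fst]]) auto
  have "(\<integral>\<^sup>+\<omega>. ennreal (exp (\<beta> * random_motion c N \<theta> t \<omega>)) * indicator {\<omega> \<in> space M. N t \<omega> = n} \<omega> \<partial>M) =
      (\<integral>\<^sup>+\<omega>. f ((N t \<omega>, switch_vector n \<omega>), angle_vector (Suc n) \<omega>) \<partial>M)"
    by (intro nn_integral_cong)
       (auto simp: f_def indicator_def random_motion_eq_switch_gap switch_vector_def angle_vector_def
         sum_distrib_left mult.assoc simp del: sum.lessThan_Suc intro!: sum.cong)
  also have "\<dots> = (\<integral>\<^sup>+\<omega>. \<integral>\<^sup>+y. f ((N t \<omega>, switch_vector n \<omega>), y)
      \<partial>distr M (PiM {1..Suc n} (\<lambda>_. borel)) (angle_vector (Suc n)) \<partial>M)"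
    by (rule nn_integral_switch_angle[OF f])
  also have "\<dots> = (\<integral>\<^sup>+\<omega>. indicator {\<omega> \<in> space M. N t \<omega> = n} \<omega> * ennreal (\<Prod>j<Suc n. 2 powr \<nu> * Gamma (\<nu> + 1) *
      bessel_I_quot \<nu> (\<beta> * c * switch_gap n t (switch_vector n \<omega>) j)) \<partial>M)"
    by (intro nn_integral_cong)
       (auto simp: f_def indicator_def nn_integral_exp_angle_vector[unfolded One_nat_def] simp del: sum.lessThan_Suc prod.lessThan_Suc)
  finally show ?thesis .
qed

lemma cond_mgf_random_motion:
  "cond_expect_event M (\<lambda>\<omega>. exp (\<beta> * random_motion c N \<theta> t \<omega>)) (\<lambda>\<omega>. N t \<omega> = n) =
     fact n / t ^ n * (2 powr \<nu> * Gamma (\<nu> + 1)) ^ (n + 1) *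
     iterated_integral t n 0 (\<lambda>ss. let s = 0 # ss @ [t] in
       \<Prod>j = 1..n + 1. bessel_I_quot \<nu> (\<beta> * c * (s ! j - s ! (j - 1))))"
proof -
  let ?A = "{\<omega> \<in> space M. N t \<omega> = n}" and ?D = "open_order_simplex 0 n 0 t"
  define K where "K = 2 powr \<nu> * Gamma (\<nu> + 1)"
  define r where "r = rate ^ n * exp (- (rate * t))"
  define G where "G ss = (let s = 0 # ss @ [t] in
       \<Prod>j = 1..n + 1. bessel_I_quot \<nu> (\<beta> * c * (s ! j - s ! (j - 1))))" for ss
  define H where "H x = (\<Prod>j<Suc n. K * bessel_I_quot \<nu> (\<beta> * c * switch_gap n t x j))" for x
  define I where "I = iterated_integral t n 0 G"
  have K: "0 \<le> K" using \<nu> by (simp add: K_def)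
  have r: "0 < r" using rate by (simp add: r_def)
  have HG: "H x = K ^ (n + 1) * G (map x [0..<n])" for x
    unfolding H_def G_def prod_list_gaps_eq_switch_gap[where f = "\<lambda>d. bessel_I_quot \<nu> (\<beta> * c * d)"]
    by (simp add: prod.distrib del: prod.lessThan_Suc)
  have G_borel: "(\<lambda>x. G (map x [0..<n])) \<in> borel_measurable (PiM {0..<n} (\<lambda>_. borel))"
    unfolding G_def prod_list_gaps_eq_switch_gap[where f = "\<lambda>d. bessel_I_quot \<nu> (\<beta> * c * d)"]
  proof (rule borel_measurable_prod)
    fix j assume "j \<in> {..<Suc n}"
    then have [measurable]: "(\<lambda>x. switch_gap n t x j) \<in> borel_measurable (PiM {0..<n} (\<lambda>_. borel))"
      by (intro borel_measurable_switch_gap) auto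
    show "(\<lambda>x. bessel_I_quot \<nu> (\<beta> * c * switch_gap n t x j)) \<in> borel_measurable (PiM {0..<n} (\<lambda>_. borel))"
      by measurable
  qed
  then have G_meas: "(\<lambda>x. G (map x [0..<0 + n])) \<in> borel_measurable (PiM {0..<0 + n} (\<lambda>_. lborel))"
    by (simp cong: measurable_cong_sets sets_PiM_cong)
  have H_meas: "H \<in> borel_measurable (PiM {0..<n} (\<lambda>_. borel))"
    unfolding HG[abs_def] using G_borel by (intro borel_measurable_times) auto
  \<comment> \<open>The lists need not be increasing, so gaps are bounded in absolute value: two
    points of \<open>{0..t}\<close> differ by at most \<open>t\<close>.\<close>
  have G_bounds: "0 \<le> G ss \<and> G ss \<le> (\<Prod>j = 1..n + 1. bessel_I_quot \<nu> (\<bar>\<beta> * c\<bar> * t))"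
    if ss: "set ss \<subseteq> {0..t}" "length ss = n" for ss
  proof -
    let ?s = "0 # ss @ [t]"
    have s: "?s ! j \<in> {0..t}" if "j \<le> n + 1" for j
    proof -
      have "?s ! j \<in> set ?s" using that ss by (intro nth_mem) simp
      then show ?thesis using ss t by auto
    qed
    have "\<bar>?s ! j - ?s ! (j - 1)\<bar> \<le> t" if "j \<in> {1..n + 1}" for j
    proof -
      have "\<bar>u - v\<bar> \<le> t" if "u \<in> {0..t}" "v \<in> {0..t}" for u v using that by auto
      then show ?thesis using that by (meson s atLeastAtMost_iff diff_le_self le_trans)
    qed
    then have "\<bar>\<beta> * c * (?s ! j - ?s ! (j - 1))\<bar> \<le> \<bar>\<beta> * c\<bar> * t" if "j \<in> {1..n + 1}" for j
      using that unfolding abs_mult by (intro mult_left_mono) auto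
    then show ?thesis
      unfolding G_def Let_def using \<nu>
      by (intro conjI prod_nonneg prod_mono bessel_I_quot_nonneg bessel_I_quot_mono) auto
  qed
  have I: "0 \<le> I" "ennreal I = (\<integral>\<^sup>+x. ennreal (G (map x [0..<n])) * indicator ?D x \<partial>PiM {0..<n} (\<lambda>_. lborel))"
    using iterated_integral_eq_nn_integral[OF _ G_meas G_bounds, of 0] t unfolding I_def by auto
  have A [measurable]: "?A \<in> sets M"
  proof -
    have "?A = N t -` {n} \<inter> space M" by auto
    also have "\<dots> \<in> sets M" using t by (intro measurable_sets[OF measurable_N]) auto
    finally show ?thesis .
  qed
  have PA: "emeasure M ?A = ennreal (r * t ^ n / fact n)"
  proof -
    have "?A = (\<lambda>\<omega>. N t \<omega> - N 0 \<omega>) -` {n} \<inter> space M"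
      using N by (auto simp: poisson_process_def)
    then show ?thesis
      using poisson_process_increment_prob[OF N rate, of 0 t n] t
      by (simp add: emeasure_eq_measure r_def power_mult_distrib mult_ac)
  qed
  have motion: "random_motion c N \<theta> t \<in> borel_measurable M"
  proof -
    have "(\<lambda>\<omega>. \<Sum>j = 1..k + 1. (switch_time N t j \<omega> - switch_time N t (j - 1) \<omega>) * cos (\<theta> j \<omega>))
        \<in> borel_measurable M" for k
    proof (rule borel_measurable_sum)
      fix j assume "j \<in> {1..k + 1}"
      then obtain i where "j = Suc i" by (cases j) auto
      then show "(\<lambda>\<omega>. (switch_time N t j \<omega> - switch_time N t (j - 1) \<omega>) * cos (\<theta> j \<omega>)) \<in> borel_measurable M"
        by simp
    qed
    \<comment> \<open>The number of summands is random; measurability follows by splitting along the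
      countably many values of \<open>N t\<close>.\<close>
    from measurable_compose_countable[OF this measurable_N] show ?thesis
      unfolding random_motion_def[abs_def] using t by simp
  qed
  have "(\<integral>\<^sup>+\<omega>. ennreal (exp (\<beta> * random_motion c N \<theta> t \<omega>)) * indicator ?A \<omega> \<partial>M) =
      (\<integral>\<^sup>+\<omega>. indicator ?A \<omega> * ennreal (H (switch_vector n \<omega>)) \<partial>M)"
    unfolding nn_integral_exp_random_motion H_def K_def ..
  also have "\<dots> = (\<integral>\<^sup>+x. ennreal (H x) \<partial>distr (density M (indicator ?A)) (PiM {0..<n} (\<lambda>_. borel)) (switch_vector n))"
    using H_meas by (simp add: nn_integral_distr nn_integral_density)
  also have "\<dots> = (\<integral>\<^sup>+x. ennreal (H x) \<partial>density (PiM {0..<n} (\<lambda>_. lborel)) (\<lambda>x. ennreal r * indicator ?D x))"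
    unfolding switch_vector_def[abs_def] poisson_process_switch_times_distr[OF N rate t] r_def ..
  also have "\<dots> = (\<integral>\<^sup>+x. ennreal r * indicator ?D x * ennreal (H x) \<partial>PiM {0..<n} (\<lambda>_. lborel))"
  proof (rule nn_integral_density)
    have "H \<in> borel_measurable (PiM {0..<n} (\<lambda>_. lborel))"
      using H_meas by (simp cong: measurable_cong_sets sets_PiM_cong)
    then show "(\<lambda>x. ennreal (H x)) \<in> borel_measurable (PiM {0..<n} (\<lambda>_. lborel))"
      by (rule measurable_compose[OF _ measurable_ennreal])
  qed (use sets_open_order_simplex_lborel[of 0 n 0 t] in simp)
  also have "\<dots> = (\<integral>\<^sup>+x. ennreal (r * K ^ (n + 1)) * (ennreal (G (map x [0..<n])) * indicator ?D x) \<partial>PiM {0..<n} (\<lambda>_. lborel))"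
    unfolding HG using r K by (intro nn_integral_cong) (simp add: ennreal_mult' mult_ac)
  also have "\<dots> = ennreal (r * K ^ (n + 1) * I)"
    using G_meas sets_open_order_simplex_lborel[of 0 n 0 t] r K I
    by (subst nn_integral_cmult) (auto simp: ennreal_mult)
  finally have E: "(\<integral>\<^sup>+\<omega>. ennreal (exp (\<beta> * random_motion c N \<theta> t \<omega>)) * indicator ?A \<omega> \<partial>M) = ennreal (r * K ^ (n + 1) * I)" .
  have "cond_expect_event M (\<lambda>\<omega>. exp (\<beta> * random_motion c N \<theta> t \<omega>)) (\<lambda>\<omega>. N t \<omega> = n) =
      enn2real (\<integral>\<^sup>+\<omega>. ennreal (exp (\<beta> * random_motion c N \<theta> t \<omega>)) \<partial>uniform_measure M ?A)"
    unfolding cond_expect_event_def using motion by (intro integral_eq_nn_integral) auto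
  also have "\<dots> = enn2real (ennreal (r * K ^ (n + 1) * I) / ennreal (r * t ^ n / fact n))"
    using motion A by (subst nn_integral_uniform_measure) (auto simp: E PA)
  \<comment> \<open>The conditioning event has positive probability, so this is a quotient of reals,
    in which \<open>r\<close> cancels.\<close>
  also have "\<dots> = r * K ^ (n + 1) * I / (r * t ^ n / fact n)"
    using r t K I(1) by (subst divide_ennreal) auto
  also have "\<dots> = fact n / t ^ n * K ^ (n + 1) * I"
    using r by simp
  finally show ?thesis unfolding I_def G_def K_def .
qed

end

theorem theorem2p2:
  fixes M :: "'a measure"
    and N :: "real \<Rightarrow> 'a \<Rightarrow> nat"
    and \<theta> :: "nat \<Rightarrow> 'a \<Rightarrow> real"
    and c rate \<nu> t \<beta> :: real
  assumes "prob_space M"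
    and "c > 0" and "rate > 0" and "\<nu> \<ge> 0" and "t > 0"
    and "poisson_process M rate N"
    and "\<And>j. j \<ge> 1 \<Longrightarrow> distributed M lborel (\<theta> j) (\<lambda>x. ennreal (angle_density \<nu> x))"
    and "prob_space.indep_vars M (\<lambda>_. borel) \<theta> {1..}"
    and "prob_space.indep_set M
           (generated_sigma M {0..} (count_space UNIV) N)
           (generated_sigma M {1..} borel \<theta>)"
  shows "(\<forall>n\<ge>1.
           cond_expect_event M (\<lambda>\<omega>. exp (\<beta> * random_motion c N \<theta> t \<omega>)) (\<lambda>\<omega>. N t \<omega> = n) =
             fact n / t ^ n * (2 powr \<nu> * Gamma (\<nu> + 1)) ^ (n + 1) *
             iterated_integral t n 0 (\<lambda>ss. let s = 0 # ss @ [t] in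
               \<Prod>j = 1..n + 1. bessel_I_quot \<nu> (\<beta> * c * (s ! j - s ! (j - 1))))) \<and>
         cond_expect_event M (\<lambda>\<omega>. exp (\<beta> * random_motion c N \<theta> t \<omega>)) (\<lambda>\<omega>. N t \<omega> = 0) =
           2 powr \<nu> * Gamma (\<nu> + 1) * bessel_I_quot \<nu> (\<beta> * c * t)"
proof -
  interpret prob_space M by fact
  interpret poisson_random_motion M N \<theta> rate \<nu> t
    using assms by unfold_locales
  show ?thesis
    \<comment> \<open>For \<open>n = 0\<close> the iterated integral is its integrand at the empty
      list: one factor, with gap \<open>t\<close>.\<close>
    using cond_mgf_random_motion[of \<beta> c 0] cond_mgf_random_motion[of \<beta> c] by simp
qed

end
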